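(* Let $T$ be a nontrivial tree of order $n$ and diameter $\delta$. Then: \begin{itemize} \item if $\delta$ is odd, $$\kappa(T)\geq\frac{1}{n-1}\left(\frac{n\delta^2}{2}-\frac{\delta^3}{6}+n^2-n\delta-\frac{\delta^2}{2}-2n+\frac{7}{6}\delta+1\right);$$ \item if $\delta$ is even, $$\kappa(T)\geq\frac{1}{n-1}\left(\frac{n\delta^2}{2}-\frac{\delta^3}{6}+n^2-n\delta-\frac{\delta^2}{2}-\frac{5}{2}n+\frac{5}{3}\delta+\frac{3}{2}\right).$$ \end{itemize} Additionally, in both cases, $T$ satisfies the bound with equality if and only if $T$ is (isomorphic to) the caterpillar $C_{\delta+1}((n-\delta-1)\mathbf{e}_t)$, with $t=\lceil\frac{\delta+1}{2}\rceil$, where $\mathbf{e}_t$ is the $t$-th unit vector in $\mathbb{R}^{\delta+1}$.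
   Context: All graphs are finite, simple and undirected; isomorphic graphs are identified. The order of a graph is its number of vertices; a graph is trivial if it has exactly one vertex. For a nontrivial connected graph $G$ on vertices $1,\dots,n$ with adjacency matrix $A$ and diagonal degree matrix $D$, consider the random walk on $G$ with transition matrix $D^{-1}A$. Let $\mathbf{w}=(w_j)$ be its unique stationary distribution ($\mathbf{w}^TD^{-1}A=\mathbf{w}^T$, positive entries summing to $1$), and let $m_{ij}$ be the expected value of the smallest $s\geq 1$ such that the walk started at $i$ is at $j$ at time $s$ (so $m_{ii}$ is the mean return time). Kemeny's constant of $G$ is $\kappa(G)=\sum_{j=1}^n m_{ij}w_j-1$, which does not depend on $i$. For a positive integer $k$ and a nonnegative integer vector $\mathbf{p}=(p_1,\dots,p_k)$, the caterpillar $C_k(\mathbf{p})$ is the tree consisting of a path $c_1c_2\dots c_k$ on $k$ vertices together with $p_i$ pendent (degree-one) vertices attached to $c_i$ for each $i\le k$. *)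

theory Defs
  imports
    "HOL-Probability.Probability"
    "Graph_Theory.Digraph_Isomorphism"
begin

section \<open>Graphs\<close>

text \<open>
  A finite simple undirected graph is a \<open>pair_graph\<close>: a finite loopfree digraph without parallel
  arcs whose arc relation is symmetric, each edge being represented by its two orientations.
  For this reason \<open>Digraph_Component.forest\<close> and \<open>Digraph_Component.tree\<close> are unusable here:
  an edge traversed back and forth is a \<open>cycle\<close> of length 2 in that theory. The cycles of
  the undirected graph are those of length at least 3.
\<close>

definition undirected_tree :: "'a pair_pre_digraph \<Rightarrow> bool" where
  "undirected_tree G \<longleftrightarrow>
     pair_graph G \<and> Digraph_Component.connected (with_proj G) \<and>
     \<not> (\<exists>p. pre_digraph.cycle (with_proj G) p \<and> 3 \<le> length p)"

definition graph_dist :: "'a pair_pre_digraph \<Rightarrow> 'a \<Rightarrow> 'a \<Rightarrow> nat" where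
  "graph_dist G u v = (LEAST k. \<exists>p. pre_digraph.awalk (with_proj G) u p v \<and> length p = k)"

definition graph_diameter :: "'a pair_pre_digraph \<Rightarrow> nat" where
  "graph_diameter G = Max {graph_dist G u v | u v. u \<in> pverts G \<and> v \<in> pverts G}"

text \<open>
  The spine vertex \<open>c\<^sub>i\<close> is \<open>(i, 0)\<close>; the pendent vertices at \<open>c\<^sub>i\<close> are
  \<open>(i, 1), \<dots>, (i, p i)\<close>. Only the values of \<open>p\<close> at \<open>1, \<dots>, k\<close> matter.
\<close>

definition caterpillar :: "nat \<Rightarrow> (nat \<Rightarrow> nat) \<Rightarrow> (nat \<times> nat) pair_pre_digraph" where
  "caterpillar k p =
     (let E = {((i, 0), (Suc i, 0)) | i. 1 \<le> i \<and> i < k} \<union>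
              {((i, 0), (i, j)) | i j. 1 \<le> i \<and> i \<le> k \<and> 1 \<le> j \<and> j \<le> p i}
      in \<lparr>pverts = {(i, j). 1 \<le> i \<and> i \<le> k \<and> j \<le> p i}, parcs = E \<union> E\<inverse>\<rparr>)"

definition unit_vec :: "nat \<Rightarrow> nat \<Rightarrow> nat" where
  "unit_vec t i = (if i = t then 1 else 0)"


section \<open>The random walk on a graph\<close>

definition neighbours :: "'a pair_pre_digraph \<Rightarrow> 'a \<Rightarrow> 'a set" where
  "neighbours G u = {v. (u, v) \<in> parcs G}"

definition adjacency :: "'a pair_pre_digraph \<Rightarrow> 'a \<Rightarrow> 'a \<Rightarrow> real" where
  "adjacency G u v = of_bool ((u, v) \<in> parcs G)"

definition transition :: "'a pair_pre_digraph \<Rightarrow> 'a \<Rightarrow> 'a \<Rightarrow> real" where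
  "transition G u v = adjacency G u v / real (out_degree (with_proj G) u)"

definition is_stationary :: "'a pair_pre_digraph \<Rightarrow> ('a \<Rightarrow> real) \<Rightarrow> bool" where
  "is_stationary G w \<longleftrightarrow>
     (\<forall>j. j \<notin> pverts G \<longrightarrow> w j = 0) \<and>
     (\<forall>j\<in>pverts G. 0 < w j) \<and>
     (\<Sum>j\<in>pverts G. w j) = 1 \<and>
     (\<forall>j\<in>pverts G. (\<Sum>i\<in>pverts G. w i * transition G i j) = w j)"

definition stationary :: "'a pair_pre_digraph \<Rightarrow> 'a \<Rightarrow> real" where
  "stationary G = (THE w. is_stationary G w)"

text \<open>
  The walk is realised by independent uniformly random maps sending each vertex to one of
  its neighbours, one map for each unit of time. \<open>random_walk_path\<close> below shows that this has
  the law of the Markov chain with transition matrix \<open>transition G\<close>.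
\<close>

definition walk_space :: "'a pair_pre_digraph \<Rightarrow> ('a \<Rightarrow> 'a) stream measure" where
  "walk_space G = stream_space (uniform_count_measure (\<Pi>\<^sub>E v\<in>pverts G. neighbours G v))"

primrec walk :: "'a \<Rightarrow> ('a \<Rightarrow> 'a) stream \<Rightarrow> nat \<Rightarrow> 'a" where
  "walk i \<omega> 0 = i"
| "walk i \<omega> (Suc s) = (\<omega> !! s) (walk i \<omega> s)"

definition hitting_time :: "'a \<Rightarrow> 'a \<Rightarrow> ('a \<Rightarrow> 'a) stream \<Rightarrow> ennreal" where
  "hitting_time i j \<omega> = (INF s\<in>{s. 1 \<le> s \<and> walk i \<omega> s = j}. of_nat s)"

text \<open>
  The infimum over the empty set is \<open>\<infinity>\<close>. For a connected nontrivial \<open>G\<close> the expectation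
  is finite, so that \<open>enn2real\<close> loses nothing.
\<close>

definition mean_first_passage :: "'a pair_pre_digraph \<Rightarrow> 'a \<Rightarrow> 'a \<Rightarrow> real" where
  "mean_first_passage G i j = enn2real (\<integral>\<^sup>+ \<omega>. hitting_time i j \<omega> \<partial>walk_space G)"

text \<open>The sum does not depend on the starting vertex \<open>i\<close> when \<open>G\<close> is connected and nontrivial.\<close>

definition kemeny :: "'a pair_pre_digraph \<Rightarrow> real" where
  "kemeny G = (THE c. \<forall>i\<in>pverts G.
     c = (\<Sum>j\<in>pverts G. mean_first_passage G i j * stationary G j) - 1)"


subsection \<open>The law of the walk\<close>

lemma walk_Stream: "walk i (f ## \<omega>) (Suc s) = walk (f i) \<omega> s"
  by (induction s) auto

context
  fixes G :: "'a pair_pre_digraph"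
  assumes G: "pair_graph G"
    and no_isolated: "\<And>v. v \<in> pverts G \<Longrightarrow> neighbours G v \<noteq> {}"
begin

interpretation pair_graph G by (rule G)

lemma neighbours_subset: "neighbours G v \<subseteq> pverts G"
  by (auto simp: neighbours_def dest: in_arcsD2)

lemma finite_neighbours: "finite (neighbours G v)"
  using neighbours_subset pair_finite_verts finite_subset by blast

lemma card_neighbours: "card (neighbours G v) = out_degree (with_proj G) v"
proof -
  have "out_arcs (with_proj G) v = Pair v ` neighbours G v"
    by (auto simp: out_arcs_def neighbours_def)
  then show ?thesis
    by (simp add: out_degree_def card_image inj_on_def)
qed

private abbreviation (input) "maps \<equiv> \<Pi>\<^sub>E v\<in>pverts G. neighbours G v"
private abbreviation (input) "Step \<equiv> uniform_count_measure maps"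

lemma finite_maps: "finite maps"
  by (intro finite_PiE pair_finite_verts finite_neighbours)

lemma maps_nonempty: "maps \<noteq> {}"
  using no_isolated by (simp add: PiE_eq_empty_iff)

lemma prob_space_Step: "prob_space Step"
  by (rule prob_space_uniform_count_measure[OF finite_maps maps_nonempty])

lemma prob_space_walk_space: "prob_space (walk_space G)"
  unfolding walk_space_def
  by (rule prob_space.prob_space_stream_space[OF prob_space_Step])

lemma measurable_walk:
  assumes "i \<in> pverts G"
  shows "(\<lambda>\<omega>. walk i \<omega> s) \<in> walk_space G \<rightarrow>\<^sub>M count_space (pverts G)"
proof (induction s)
  case 0
  show ?case using assms by simp
next
  case (Suc s)
  have "(\<lambda>\<omega>. (\<omega> !! s) v) \<in> walk_space G \<rightarrow>\<^sub>M count_space (pverts G)" if "v \<in> pverts G" for v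
  proof (rule measurable_compose[where N = Step])
    show "(\<lambda>\<omega>. \<omega> !! s) \<in> walk_space G \<rightarrow>\<^sub>M Step"
      unfolding walk_space_def by (rule measurable_snth)
    show "(\<lambda>f. f v) \<in> Step \<rightarrow>\<^sub>M count_space (pverts G)"
      using that neighbours_subset
      by (auto simp: measurable_def space_uniform_count_measure sets_uniform_count_measure)
  qed
  then show ?case
    unfolding walk.simps
    by (rule measurable_compose_countable'[OF _ Suc])
       (auto intro: countable_finite pair_finite_verts)
qed

lemma measure_Step:
  assumes i: "i \<in> pverts G"
  shows "emeasure Step {f \<in> maps. f i = x} = ennreal (transition G i x)"
proof (cases "x \<in> neighbours G i")
  case False
  then have "{f \<in> maps. f i = x} = {}" using i by auto
  moreover have "transition G i x = 0"
    using False by (simp add: transition_def adjacency_def neighbours_def)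
  ultimately show ?thesis by (simp only: emeasure_empty ennreal_0)
next
  case True
  let ?N = "\<lambda>v. if v = i then {x} else neighbours G v"
  have eq: "{f \<in> maps. f i = x} = Pi\<^sub>E (pverts G) ?N"
  proof (intro set_eqI iffI)
    fix f assume f: "f \<in> {f \<in> maps. f i = x}"
    show "f \<in> Pi\<^sub>E (pverts G) ?N"
    proof (rule PiE_I)
      show "f v \<in> ?N v" if "v \<in> pverts G" for v
        using f that PiE_mem[of f "pverts G" "neighbours G" v] by simp
      show "f v = undefined" if "v \<notin> pverts G" for v
        using f that PiE_arb[of f "pverts G" "neighbours G" v] by simp
    qed
  next
    fix f assume f: "f \<in> Pi\<^sub>E (pverts G) ?N"
    have "f \<in> maps"
    proof (rule PiE_I)
      show "f v \<in> neighbours G v" if "v \<in> pverts G" for v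
        using PiE_mem[OF f that] True by (cases "v = i") simp_all
      show "f v = undefined" if "v \<notin> pverts G" for v
        using PiE_arb[OF f that] .
    qed
    moreover have "f i = x" using PiE_mem[OF f i] by simp
    ultimately show "f \<in> {f \<in> maps. f i = x}" by simp
  qed
  let ?R = "\<Prod>v\<in>pverts G - {i}. card (neighbours G v)"
  have R: "?R \<noteq> 0"
    using no_isolated finite_neighbours pair_finite_verts
    by (simp add: card_eq_0_iff)
  have "card {f \<in> maps. f i = x} = (\<Prod>v\<in>pverts G. card (?N v))"
    unfolding eq by (rule card_PiE[OF pair_finite_verts])
  also have "\<dots> = card (?N i) * (\<Prod>v\<in>pverts G - {i}. card (?N v))"
    by (rule prod.remove[OF pair_finite_verts i])
  also have "(\<Prod>v\<in>pverts G - {i}. card (?N v)) = ?R"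
    by (rule prod.cong) auto
  finally have "card {f \<in> maps. f i = x} = ?R" by simp
  moreover have "card maps = card (neighbours G i) * ?R"
    unfolding card_PiE[OF pair_finite_verts] by (rule prod.remove[OF pair_finite_verts i])
  moreover have "emeasure Step {f \<in> maps. f i = x} =
      ennreal (real (card {f \<in> maps. f i = x}) / real (card maps))"
    by (rule emeasure_uniform_count_measure[OF finite_maps]) auto
  moreover have "transition G i x = 1 / real (card (neighbours G i))"
    using True unfolding card_neighbours by (simp add: transition_def adjacency_def neighbours_def)
  ultimately show ?thesis
    using R by (simp only: of_nat_mult) simp
qed

lemma random_walk_path:
  assumes "i \<in> pverts G"
  shows "measure (walk_space G)
           {\<omega> \<in> space (walk_space G). \<forall>k<length xs. walk i \<omega> (Suc k) = xs ! k} =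
         (\<Prod>k<length xs. transition G ((i # xs) ! k) (xs ! k))"
proof -
  interpret W: prob_space "walk_space G" by (rule prob_space_walk_space)
  let ?E = "\<lambda>i xs. {\<omega> \<in> space (walk_space G). \<forall>k<length xs. walk i \<omega> (Suc k) = xs ! k}"
  have sets: "?E i xs \<in> sets (walk_space G)" if "i \<in> pverts G" for i xs
  proof -
    have "{\<omega> \<in> space (walk_space G). walk i \<omega> s = y} \<in> sets (walk_space G)" for s y
    proof -
      have "{\<omega> \<in> space (walk_space G). walk i \<omega> s = y} =
          (\<lambda>\<omega>. walk i \<omega> s) -` ({y} \<inter> pverts G) \<inter> space (walk_space G)"
        using measurable_space[OF measurable_walk[OF that, of s]] by auto
      then show ?thesis
        using measurable_sets[OF measurable_walk[OF that, of s], of "{y} \<inter> pverts G"] by simp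
    qed
    note single = this
    show ?thesis
    proof (rule sets.sets_Collect_countable_All)
      fix k
      show "{\<omega> \<in> space (walk_space G). k < length xs \<longrightarrow> walk i \<omega> (Suc k) = xs ! k} \<in> sets (walk_space G)"
        using single[of "Suc k" "xs ! k"] by (cases "k < length xs") simp_all
    qed
  qed
  have nn: "0 \<le> transition G u v" for u v
    by (simp add: transition_def adjacency_def)
  have "emeasure (walk_space G) (?E i xs) =
      ennreal (\<Prod>k<length xs. transition G ((i # xs) ! k) (xs ! k))"
    using assms
  proof (induction xs arbitrary: i)
    case Nil
    have "?E i [] = space (walk_space G)" by auto
    then show ?case by (simp only: W.emeasure_space_1) simp
  next
    case (Cons x xs)
    interpret S: prob_space Step by (rule prob_space_Step)
    have "emeasure (walk_space G) (?E i (x # xs)) =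
        (\<integral>\<^sup>+ f. emeasure (walk_space G) {\<omega> \<in> space (walk_space G). f ## \<omega> \<in> ?E i (x # xs)} \<partial>Step)"
      unfolding walk_space_def
      by (rule S.emeasure_stream_space[OF sets[OF Cons.prems, unfolded walk_space_def]])
    also have "\<dots> = (\<integral>\<^sup>+ f. emeasure (walk_space G) (?E x xs) * indicator {f \<in> maps. f i = x} f \<partial>Step)"
    proof (intro nn_integral_cong)
      fix f assume f: "f \<in> space Step"
      then have fm: "f \<in> maps" by (simp add: space_uniform_count_measure)
      have sp: "f ## \<omega> \<in> space (walk_space G)" if "\<omega> \<in> space (walk_space G)" for \<omega>
        using that f by (simp only: walk_space_def space_stream_space streams_Stream)
      have path: "(\<forall>k<length (x # xs). walk i (f ## \<omega>) (Suc k) = (x # xs) ! k) \<longleftrightarrow>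
          f i = x \<and> (\<forall>k<length xs. walk (f i) \<omega> (Suc k) = xs ! k)" for \<omega>
        by (simp only: length_Cons All_less_Suc2 walk_Stream walk.simps(1) nth_Cons_0 nth_Cons_Suc)
      have "{\<omega> \<in> space (walk_space G). f ## \<omega> \<in> ?E i (x # xs)} = (if f i = x then ?E x xs else {})"
        unfolding mem_Collect_eq path using sp by auto
      then show "emeasure (walk_space G) {\<omega> \<in> space (walk_space G). f ## \<omega> \<in> ?E i (x # xs)} =
          emeasure (walk_space G) (?E x xs) * indicator {f \<in> maps. f i = x} f"
        using fm by (simp add: indicator_def)
    qed
    also have "\<dots> = emeasure (walk_space G) (?E x xs) * emeasure Step {f \<in> maps. f i = x}"
      by (rule nn_integral_cmult_indicator) (simp add: sets_uniform_count_measure)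
    also have "\<dots> = emeasure (walk_space G) (?E x xs) * ennreal (transition G i x)"
      using measure_Step[OF Cons.prems] by simp
    also have "\<dots> = ennreal (\<Prod>k<length xs. transition G ((x # xs) ! k) (xs ! k)) * ennreal (transition G i x)"
    proof (cases "x \<in> neighbours G i")
      case True
      then have "x \<in> pverts G" using neighbours_subset by blast
      then show ?thesis by (simp only: Cons.IH)
    next
      case False
      then show ?thesis by (simp add: transition_def adjacency_def neighbours_def)
    qed
    also have "\<dots> = ennreal (\<Prod>k<length (x # xs). transition G ((i # x # xs) ! k) ((x # xs) ! k))"
      by (simp only: length_Cons prod.lessThan_Suc_shift nth_Cons_0 nth_Cons_Suc
          ennreal_mult[OF nn prod_nonneg[OF nn]] mult.commute)
    finally show ?case .
  qed
  then show ?thesis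
    unfolding measure_def by (simp only: enn2real_ennreal[OF prod_nonneg[OF nn]])
qed

end

end

theory Submission
  imports Defs
begin

text \<open>
  Write \<open>d\<close> for the distance in the tree, \<open>n\<close> for its order, and \<open>S\<close> for the sum of \<open>d u v\<close> over
  all ordered pairs of vertices (twice the Wiener index). The proof has two independent halves.

  \<^bold>\<open>Kemeny's constant is an affine function of \<open>S\<close>.\<close> For \<open>i \<noteq> j\<close> the mean hitting time of \<open>j\<close> from \<open>i\<close> is
  \<open>(\<Sum>k. deg k * (d i j + d j k - d i k)) / 2\<close>. Indeed, in a tree exactly one neighbour of a vertex
  \<open>i \<noteq> k\<close> is closer to \<open>k\<close> and all others are farther away, so the sum of \<open>d x k\<close> over the
  neighbours \<open>x\<close> of \<open>i\<close> is known, and this shows that the formula satisfies the first-step equations of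
  the random walk (\<open>sum_nb_hit\<close>). The true hitting times satisfy the same equations; they are finite
  because their truncations are dominated by the formula (\<open>truncated_hitting_time_le\<close>), and a function
  that is harmonic off one vertex is constant (\<open>harmonic_imp_constant\<close>), so the two agree. The stationary
  weight of \<open>j\<close> is \<open>deg j / (2 * (n - 1))\<close>. In the weighted sum over \<open>j\<close> the two terms that contain
  \<open>i\<close> cancel, which leaves the sum of \<open>deg j * deg k * d j k\<close>; summing \<open>d\<close> and its square over all arcs
  expresses this through \<open>S\<close>. The result is \<open>S / (n - 1) - (2 * n - 1) / 2\<close> (\<open>kemeny_eq\<close>).

  \<^bold>\<open>The least \<open>S\<close> for a given diameter.\<close> Fix a path \<open>c 0, \<dots>, c \<delta>\<close> that realises the diameter \<open>\<delta>\<close>.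
  Pairs on the path contribute a constant. A vertex \<open>u\<close> off the path lies on no geodesic between path
  vertices, so by parity \<open>d u (c i) + d u (c j) \<ge> \<bar>i - j\<bar> + 2\<close>; adding this up for \<open>j = \<delta> - i\<close> bounds the
  total distance from \<open>u\<close> to the path. Two vertices off the path have distance at least 2 unless they are
  adjacent, and for such a pair the vertex farther from the path has a total distance to the path that
  exceeds the bound by more than the pair saves (\<open>path_sum_ge_parents\<close>). Equality leaves no adjacent pairs
  off the path, makes every vertex off the path a neighbour of a central path vertex, and makes all of
  them share that vertex (\<open>dist_sum_eq_imp_hub\<close>): the tree is the caterpillar of the theorem.

  Both halves use the tree only through its metric. The locale \<open>tree_metric\<close> collects the properties
  that are needed, and \<open>tree_graph\<close> derives them from connectedness and the
  absence of cycles.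
\<close>

section \<open>Sums of absolute differences\<close>

lemma sum_reflect: "(\<Sum>i\<le>m. f (m - i)) = (\<Sum>i\<le>m. f i)" for f :: "nat \<Rightarrow> 'b::comm_monoid_add"
  by (rule sum.reindex_bij_witness[of _ "\<lambda>i. m - i" "\<lambda>i. m - i"]) auto

lemma sum_abs_diff: "3 * (\<Sum>i\<le>m. \<Sum>j\<le>m. \<bar>int i - int j\<bar>) = int m * (int m + 1) * (int m + 2)"
proof (induction m)
  case (Suc m)
  have gauss: "2 * (\<Sum>i\<le>m. int (Suc m) - int i) = (int m + 1) * (int m + 2)" for m
  proof -
    have "(\<Sum>i\<le>m. int (Suc m) - int i) = (\<Sum>i\<le>m. int i + 1)"
      by (rule sum.reindex_bij_witness[of _ "\<lambda>i. m - i" "\<lambda>i. m - i"]) auto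
    moreover have "2 * (\<Sum>i\<le>m. int i + 1) = (int m + 1) * (int m + 2)"
      by (induction m) (auto simp: algebra_simps)
    ultimately show ?thesis by simp
  qed
  have "(\<Sum>i\<le>Suc m. \<Sum>j\<le>Suc m. \<bar>int i - int j\<bar>) =
      (\<Sum>i\<le>m. \<Sum>j\<le>m. \<bar>int i - int j\<bar>) + (\<Sum>i\<le>m. \<bar>int i - int (Suc m)\<bar>) + (\<Sum>j\<le>m. \<bar>int (Suc m) - int j\<bar>)"
    by (simp add: sum.distrib)
  also have "(\<Sum>i\<le>m. \<bar>int i - int (Suc m)\<bar>) = (\<Sum>i\<le>m. int (Suc m) - int i)"
    by (intro sum.cong) auto
  also have "(\<Sum>j\<le>m. \<bar>int (Suc m) - int j\<bar>) = (\<Sum>i\<le>m. int (Suc m) - int i)"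
    by (intro sum.cong) auto
  finally have "3 * (\<Sum>i\<le>Suc m. \<Sum>j\<le>Suc m. \<bar>int i - int j\<bar>) =
      int m * (int m + 1) * (int m + 2) + 3 * ((int m + 1) * (int m + 2))"
    using Suc gauss[of m] by linarith
  then show ?case by (simp add: algebra_simps)
qed simp

text \<open>
  The two terms at the ends of the range contribute \<open>m\<close> each, and the remaining ones are the sum for
  \<open>m - 2\<close>.
\<close>

lemma sum_abs_reflect:
  "2 * (\<Sum>i\<le>m. \<bar>2 * int i - int m\<bar>) = (if even m then int m * (int m + 2) else (int m + 1)\<^sup>2)"
proof (induction m rule: less_induct)
  case (less m)
  consider "m = 0" | "m = 1" | k where "m = Suc (Suc k)"
    by (metis One_nat_def not0_implies_Suc)
  then show ?case
  proof cases
    case 3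
    have "(\<Sum>i\<le>m. \<bar>2 * int i - int m\<bar>) = int m + (\<Sum>i\<le>k. \<bar>2 * int i - int k\<bar>) + int m"
      unfolding 3 by (subst sum.atMost_Suc_shift) simp
    then show ?thesis using less.IH[of k] 3 by (auto simp: algebra_simps power2_eq_square)
  qed simp_all
qed

text \<open>
  Pairing \<open>i\<close> with \<open>m - i\<close>: the point \<open>m div 2\<close> is a median of the range, so it lies between \<open>i\<close> and
  \<open>m - i\<close>, and its distances to both add up to their distance. For odd \<open>m\<close> the other median would give
  the same sum.
\<close>

lemma sum_abs_centre:
  "2 * (\<Sum>i\<le>m. \<bar>int i - int (m div 2)\<bar>) = (\<Sum>i\<le>m. \<bar>2 * int i - int m\<bar>)"
proof -
  let ?f = "\<lambda>i. \<bar>int i - int (m div 2)\<bar>"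
  have half: "\<lbrakk>2 * q \<le> M; M \<le> 2 * q + 1\<rbrakk> \<Longrightarrow> \<bar>x - q\<bar> + \<bar>M - x - q\<bar> = \<bar>2 * x - M\<bar>" for x q M :: int
    by (smt (verit))
  have "2 * (\<Sum>i\<le>m. ?f i) = (\<Sum>i\<le>m. ?f i + ?f (m - i))"
    by (simp only: sum.distrib sum_reflect[of ?f] mult_2)
  also have "\<dots> = (\<Sum>i\<le>m. \<bar>2 * int i - int m\<bar>)"
  proof (intro sum.cong refl)
    fix i assume "i \<in> {..m}"
    then have "int (m - i) = int m - int i" by auto
    moreover have "2 * int (m div 2) \<le> int m" "int m \<le> 2 * int (m div 2) + 1"
      by linarith+
    ultimately show "?f i + ?f (m - i) = \<bar>2 * int i - int m\<bar>"
      by (simp only: half)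
  qed
  finally show ?thesis .
qed

section \<open>Trees as metric spaces\<close>

text \<open>
  A tree seen through its distance. The last two assumptions are what makes the graph a tree: towards
  every target \<open>k\<close> there is one neighbour that decreases the distance, and no second neighbour that
  fails to increase it.
\<close>

locale tree_metric =
  fixes V :: "'a set" and nb :: "'a \<Rightarrow> 'a set" and d :: "'a \<Rightarrow> 'a \<Rightarrow> nat"
  assumes finite_V: "finite V"
    and nb_subset: "nb u \<subseteq> V"
    and d_eq_0_iff: "\<lbrakk>u \<in> V; v \<in> V\<rbrakk> \<Longrightarrow> d u v = 0 \<longleftrightarrow> u = v"
    and d_commute: "\<lbrakk>u \<in> V; v \<in> V\<rbrakk> \<Longrightarrow> d u v = d v u"
    and d_triangle: "\<lbrakk>u \<in> V; v \<in> V; w \<in> V\<rbrakk> \<Longrightarrow> d u w \<le> d u v + d v w"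
    and nb_iff: "\<lbrakk>u \<in> V; v \<in> V\<rbrakk> \<Longrightarrow> v \<in> nb u \<longleftrightarrow> d u v = 1"
    and parent_exists: "\<lbrakk>u \<in> V; k \<in> V; u \<noteq> k\<rbrakk> \<Longrightarrow> \<exists>p\<in>nb u. d u k = Suc (d p k)"
    and parent_unique:
      "\<lbrakk>u \<in> V; k \<in> V; x \<in> nb u; y \<in> nb u; d x k \<le> d u k; d y k \<le> d u k\<rbrakk> \<Longrightarrow> x = y"
begin

lemma nb_in_V: "x \<in> nb u \<Longrightarrow> x \<in> V"
  using nb_subset by blast

lemma finite_nb: "finite (nb u)"
  using nb_subset finite_V finite_subset by blast

lemma nb_sym: "\<lbrakk>u \<in> V; x \<in> nb u\<rbrakk> \<Longrightarrow> u \<in> nb x"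
  using nb_iff nb_in_V d_commute by metis

lemma d_self: "u \<in> V \<Longrightarrow> d u u = 0"
  using d_eq_0_iff by blast

lemma d_nb_cases:
  assumes "u \<in> V" "x \<in> nb u" "k \<in> V"
  obtains "d x k = Suc (d u k)" | "d u k = Suc (d x k)"
proof -
  have x: "x \<in> V" using assms nb_in_V by blast
  have 1: "d u x = 1" using assms x nb_iff by blast
  then have 2: "d x u = 1" using assms x d_commute by metis
  have 3: "d x k \<le> 1 + d u k" using d_triangle[OF x assms(1,3)] 2 by simp
  have 4: "d u k \<le> 1 + d x k" using d_triangle[OF assms(1) x assms(3)] 1 by simp
  have "d x k \<noteq> d u k"
  proof
    assume eq: "d x k = d u k"
    have "u \<noteq> k" using eq 2 d_self[OF assms(3)] by auto
    then obtain p where p: "p \<in> nb u" "d u k = Suc (d p k)" using parent_exists assms by blast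
    then have "x = p" using parent_unique[OF assms(1,3,2) p(1)] eq by simp
    then show False using eq p by simp
  qed
  then show ?thesis using 3 4 that by linarith
qed

lemma d_nb: "\<lbrakk>u \<in> V; x \<in> nb u\<rbrakk> \<Longrightarrow> d u x = 1"
  using nb_iff nb_in_V by blast

text \<open>
  A tree is bipartite: passing to a neighbour changes the distance to every vertex by exactly one.
\<close>

lemma parity:
  assumes "u \<in> V" "v \<in> V" "w \<in> V"
  shows "even (d u v + d v w + d u w)"
  using assms(3)
proof (induction "d v w" arbitrary: w)
  case 0
  then show ?case using d_eq_0_iff[of v w] assms by auto
next
  case (Suc m)
  have wV: "w \<in> V" by (rule Suc.prems)
  have "w \<noteq> v" using Suc.hyps(2) d_self[OF assms(2)] by auto
  then obtain p where p: "p \<in> nb w" "d w v = Suc (d p v)"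
    using parent_exists[OF wV assms(2)] by blast
  have pV: "p \<in> V" using p(1) nb_in_V by blast
  have m: "d v p = m"
    using p(2) Suc.hyps(2) d_commute[OF wV assms(2)] d_commute[OF pV assms(2)] by simp
  have "even (d u v + d v p + d u p)" by (rule Suc.hyps(1)[OF m[symmetric] pV])
  moreover have "d u p = Suc (d u w) \<or> d u w = Suc (d u p)"
    using d_nb_cases[OF wV p(1) assms(1)] d_commute[OF assms(1) wV] d_commute[OF assms(1) pV]
    by metis
  ultimately show ?case using m Suc.hyps(2)[symmetric] by auto
qed

text \<open>
  The maximum principle. A vertex other than \<open>r\<close> where the maximum is attained passes it on to all its
  neighbours, in particular to the one closer to \<open>r\<close>; so the maximum is attained at \<open>r\<close>. The same argument
  for \<open>- e\<close> gives the minimum.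
\<close>

lemma harmonic_imp_constant:
  fixes e :: "'a \<Rightarrow> real"
  assumes r: "r \<in> V" and v: "v \<in> V"
    and harmonic: "\<And>u. \<lbrakk>u \<in> V; u \<noteq> r\<rbrakk> \<Longrightarrow> card (nb u) * e u = (\<Sum>x\<in>nb u. e x)"
  shows "e v = e r"
proof -
  have bound: "f v \<le> f r" if harm: "\<And>u. \<lbrakk>u \<in> V; u \<noteq> r\<rbrakk> \<Longrightarrow> card (nb u) * f u = (\<Sum>x\<in>nb u. f x)"
    for f :: "'a \<Rightarrow> real"
  proof -
    define M where "M = Max (f ` V)"
    have le: "f u \<le> M" if "u \<in> V" for u
      unfolding M_def using that finite_V by simp
    have "M \<in> f ` V" unfolding M_def using finite_V r by (intro Max_in) auto
    then obtain u where "u \<in> V" "f u = M" by auto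
    then have "f r = M"
    proof (induction "d u r" arbitrary: u rule: less_induct)
      case less
      show ?case
      proof (cases "u = r")
        case False
        then obtain p where p: "p \<in> nb u" "d u r = Suc (d p r)" using parent_exists less r by blast
        \<comment> \<open>nonnegative summands that add up to zero all vanish\<close>
        have "(\<Sum>x\<in>nb u. M - f x) = 0"
          using harm[OF less.prems(1) False] less.prems(2) by (simp add: sum_subtractf)
        then have "\<forall>x\<in>nb u. M - f x = 0"
          using le nb_in_V by (subst (asm) sum_nonneg_eq_0_iff) (auto simp: finite_nb)
        then have "f p = M" using p by auto
        then show ?thesis using less.hyps[of p] p nb_in_V by auto
      qed (use less in auto)
    qed
    then show ?thesis using le v by simp
  qed
  have "e v \<le> e r" by (rule bound[OF harmonic])
  moreover have "- e v \<le> - e r" by (rule bound) (simp add: harmonic sum_negf)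
  ultimately show ?thesis by simp
qed

end

section \<open>Degrees, distances and hitting times\<close>

context tree_metric
begin

text \<open>
  Every neighbour is at distance \<open>Suc (d u k)\<close> from \<open>k\<close>, except that for \<open>u \<noteq> k\<close> one neighbour is
  closer. This is the only way in which the shape of the tree enters the sums below. For \<open>u = k\<close> the
  truncated difference \<open>d u k - 1\<close> would be a wrong value, hence the case distinction.
\<close>

lemma sum_over_nb:
  fixes \<phi> :: "nat \<Rightarrow> real"
  assumes "u \<in> V" "k \<in> V"
  shows "(\<Sum>x\<in>nb u. \<phi> (d x k)) = card (nb u) * \<phi> (Suc (d u k)) +
    (if u = k then 0 else \<phi> (d u k - 1) - \<phi> (Suc (d u k)))"
proof (cases "u = k")
  case True
  have "d x k = Suc (d u k)" if "x \<in> nb u" for x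
    by (rule d_nb_cases[OF assms(1) that assms(2)]) (simp_all add: True d_self[OF assms(2)])
  then show ?thesis using True by simp
next
  case False
  then obtain p where p: "p \<in> nb u" "d u k = Suc (d p k)" using parent_exists assms by blast
  have "d x k = Suc (d u k)" if "x \<in> nb u - {p}" for x
  proof (rule d_nb_cases[OF assms(1) _ assms(2)])
    show "x \<in> nb u" using that by blast
    assume "d u k = Suc (d x k)"
    then have "x = p" using that p by (intro parent_unique[OF assms]) auto
    then show ?thesis using that by blast
  qed
  then have "(\<Sum>x\<in>nb u - {p}. \<phi> (d x k)) = (\<Sum>x\<in>nb u - {p}. \<phi> (Suc (d u k)))"
    by (intro sum.cong) auto
  moreover have "real (card (nb u)) = real (card (nb u - {p})) + 1"
    using card_Suc_Diff1[OF finite_nb p(1)] by simp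
  moreover have "(\<Sum>x\<in>nb u. \<phi> (d x k)) = \<phi> (d u k - 1) + (\<Sum>x\<in>nb u - {p}. \<phi> (d x k))"
    using sum.remove[OF finite_nb p(1), of "\<lambda>x. \<phi> (d x k)"] p(2) by simp
  ultimately show ?thesis using False by (simp add: distrib_right)
qed

text \<open>
  Both sides sum \<open>\<phi>\<close> over the end points of all arcs.
\<close>

lemma sum_nb_swap:
  fixes \<phi> :: "'a \<Rightarrow> real"
  shows "(\<Sum>u\<in>V. \<Sum>x\<in>nb u. \<phi> x) = (\<Sum>x\<in>V. card (nb x) * \<phi> x)"
proof -
  have "(\<Sum>u\<in>V. \<Sum>x\<in>nb u. \<phi> x) = (\<Sum>(u, x)\<in>Sigma V nb. \<phi> x)"
    by (intro sum.Sigma) (auto simp: finite_V finite_nb)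
  also have "\<dots> = (\<Sum>(x, u)\<in>Sigma V nb. \<phi> x)"
    by (rule sum.reindex_bij_witness[of _ prod.swap prod.swap]) (auto dest: nb_sym nb_in_V)
  also have "\<dots> = (\<Sum>x\<in>V. \<Sum>u\<in>nb x. \<phi> x)"
    by (intro sum.Sigma[symmetric]) (auto simp: finite_V finite_nb)
  finally show ?thesis by simp
qed

lemma sum_indicator_except:
  fixes a :: real
  assumes "k \<in> V"
  shows "(\<Sum>u\<in>V. if u = k then 0 else a) = a * (real (card V) - 1)"
proof -
  have "(\<Sum>u\<in>V. if u = k then 0 else a) = (\<Sum>u\<in>V. a - (if u = k then a else 0))"
    by (intro sum.cong) auto
  also have "\<dots> = a * real (card V) - a"
    using assms finite_V by (simp add: sum_subtractf mult.commute)
  finally show ?thesis by (simp add: algebra_simps)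
qed

lemma sum_nb_dist:
  assumes "u \<in> V" "k \<in> V"
  shows "(\<Sum>x\<in>nb u. real (d x k)) = card (nb u) * real (d u k) + card (nb u) - (if u = k then 0 else 2)"
  using d_eq_0_iff[OF assms] sum_over_nb[OF assms, of real]
  by (cases "d u k") (simp_all add: algebra_simps split: if_splits)

text \<open>
  The handshake lemma together with the fact that a tree has \<open>card V - 1\<close> edges: apply the arc exchange
  \<open>sum_nb_swap\<close> to the distance from \<open>k\<close>.
\<close>

lemma sum_degrees:
  assumes "k \<in> V"
  shows "(\<Sum>u\<in>V. real (card (nb u))) = 2 * (real (card V) - 1)"
proof -
  have "(\<Sum>x\<in>V. card (nb x) * real (d x k)) = (\<Sum>u\<in>V. \<Sum>x\<in>nb u. real (d x k))"
    by (rule sum_nb_swap[symmetric])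
  also have "\<dots> = (\<Sum>u\<in>V. card (nb u) * real (d u k) + card (nb u) - (if u = k then 0 else 2))"
    by (intro sum.cong refl sum_nb_dist assms)
  also have "\<dots> = (\<Sum>x\<in>V. card (nb x) * real (d x k)) + (\<Sum>u\<in>V. real (card (nb u))) - 2 * (real (card V) - 1)"
    using sum_indicator_except[OF assms, of 2] by (simp add: sum.distrib sum_subtractf)
  finally show ?thesis by simp
qed

text \<open>
  Applying the arc exchange to the distance itself only counts edges; applied to the squared distance it
  yields the first moment, since passing from \<open>x\<close> to \<open>x + 1\<close> or \<open>x - 1\<close> changes the square by a term
  linear in \<open>x\<close>.
\<close>

lemma sum_degree_dist:
  assumes "k \<in> V"
  shows "(\<Sum>u\<in>V. card (nb u) * real (d u k)) = 2 * (\<Sum>u\<in>V. real (d u k)) - (real (card V) - 1)"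
proof -
  have "(\<Sum>x\<in>V. card (nb x) * (real (d x k))\<^sup>2) = (\<Sum>u\<in>V. \<Sum>x\<in>nb u. (real (d x k))\<^sup>2)"
    by (rule sum_nb_swap[symmetric])
  also have "\<dots> = (\<Sum>u\<in>V. card (nb u) * (real (d u k))\<^sup>2 + 2 * (card (nb u) * real (d u k))
      + card (nb u) - 4 * real (d u k))"
  proof (intro sum.cong refl)
    fix u assume u: "u \<in> V"
    show "(\<Sum>x\<in>nb u. (real (d x k))\<^sup>2) = card (nb u) * (real (d u k))\<^sup>2 + 2 * (card (nb u) * real (d u k))
      + card (nb u) - 4 * real (d u k)"
      using d_eq_0_iff[OF u assms] sum_over_nb[OF u assms, of "\<lambda>n. (real n)\<^sup>2"]
      by (cases "d u k") (simp_all add: algebra_simps power2_eq_square)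
  qed
  also have "\<dots> = (\<Sum>x\<in>V. card (nb x) * (real (d x k))\<^sup>2) + 2 * (\<Sum>u\<in>V. card (nb u) * real (d u k))
     + (\<Sum>u\<in>V. real (card (nb u))) - 4 * (\<Sum>u\<in>V. real (d u k))"
    by (simp add: sum.distrib sum_subtractf sum_distrib_left)
  finally show ?thesis using sum_degrees[OF assms] by simp
qed

lemma sum_degree_degree_dist:
  assumes "V \<noteq> {}"
  shows "(\<Sum>j\<in>V. \<Sum>k\<in>V. card (nb j) * (card (nb k) * real (d j k))) =
    4 * (\<Sum>u\<in>V. \<Sum>v\<in>V. real (d u v)) - 2 * (real (card V) - 1) * (2 * real (card V) - 1)"
proof -
  obtain r where r: "r \<in> V" using assms by blast
  have sw: "(\<Sum>u\<in>V. real (d u j)) = (\<Sum>u\<in>V. real (d j u))" if "j \<in> V" for j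
    using d_commute that by (intro sum.cong) auto
  have inner: "(\<Sum>k\<in>V. card (nb k) * real (d j k)) = 2 * (\<Sum>u\<in>V. real (d j u)) - (real (card V) - 1)"
    if "j \<in> V" for j
  proof -
    have "(\<Sum>k\<in>V. card (nb k) * real (d j k)) = (\<Sum>k\<in>V. card (nb k) * real (d k j))"
      by (intro sum.cong refl) (metis d_commute that)
    then show ?thesis using sum_degree_dist[OF that] sw[OF that] by simp
  qed
  have "(\<Sum>j\<in>V. \<Sum>k\<in>V. card (nb j) * (card (nb k) * real (d j k))) =
      (\<Sum>j\<in>V. 2 * (\<Sum>u\<in>V. card (nb j) * real (d j u)) - card (nb j) * (real (card V) - 1))"
  proof (intro sum.cong refl)
    fix j assume "j \<in> V"
    then have "(\<Sum>k\<in>V. card (nb j) * (card (nb k) * real (d j k))) =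
        card (nb j) * (2 * (\<Sum>u\<in>V. real (d j u)) - (real (card V) - 1))"
      by (simp only: inner sum_distrib_left[symmetric])
    then show "(\<Sum>k\<in>V. card (nb j) * (card (nb k) * real (d j k))) =
        2 * (\<Sum>u\<in>V. card (nb j) * real (d j u)) - card (nb j) * (real (card V) - 1)"
      by (simp only: sum_distrib_left[symmetric] right_diff_distrib mult.left_commute)
  qed
  also have "\<dots> = 2 * (\<Sum>j\<in>V. \<Sum>u\<in>V. card (nb j) * real (d j u)) - (\<Sum>j\<in>V. real (card (nb j))) * (real (card V) - 1)"
    by (simp only: sum_subtractf sum_distrib_left sum_distrib_right)
  also have "(\<Sum>j\<in>V. \<Sum>u\<in>V. card (nb j) * real (d j u)) = (\<Sum>u\<in>V. \<Sum>j\<in>V. card (nb j) * real (d j u))"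
    by (rule sum.swap)
  also have "\<dots> = (\<Sum>u\<in>V. 2 * (\<Sum>v\<in>V. real (d u v)) - (real (card V) - 1))"
    by (intro sum.cong refl) (simp only: sum_degree_dist sw)
  also have "\<dots> = 2 * (\<Sum>u\<in>V. \<Sum>v\<in>V. real (d u v)) - real (card V) * (real (card V) - 1)"
    by (simp only: sum_subtractf sum_distrib_left) (simp add: right_diff_distrib)
  finally show ?thesis using sum_degrees[OF r] by (simp add: algebra_simps)
qed

text \<open>
  The expected time that the random walk on the tree needs from \<open>i\<close> to \<open>j\<close>: this is the general formula
  for hitting times in terms of effective resistances, which for a tree are the distances.
\<close>

definition hit :: "'a \<Rightarrow> 'a \<Rightarrow> real" where
  "hit i j = (\<Sum>k\<in>V. card (nb k) * (real (d i j) + real (d j k) - real (d i k))) / 2"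

lemma hit_self: "i \<in> V \<Longrightarrow> hit i i = 0"
  by (simp add: hit_def d_self)

lemma hit_nonneg: "\<lbrakk>i \<in> V; j \<in> V\<rbrakk> \<Longrightarrow> 0 \<le> hit i j"
  unfolding hit_def using d_triangle[of i j]
  by (intro divide_nonneg_pos sum_nonneg mult_nonneg_nonneg) (auto simp flip: of_nat_add)

text \<open>
  For \<open>i \<noteq> j\<close> this is the first-step equation of the hitting times of \<open>j\<close>. For \<open>i = j\<close> it yields the
  mean return time.
\<close>

lemma sum_nb_hit:
  assumes "i \<in> V" "j \<in> V"
  shows "(\<Sum>x\<in>nb i. hit x j) =
    card (nb i) * (hit i j - 1) + (if i = j then 2 * (real (card V) - 1) else 0)"
proof -
  define N where "N = real (card V) - 1"
  define c where "c = real (card (nb i))"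
  define e where "e k = (if i = k then 2 else 0 :: real)" for k
  have inner: "(\<Sum>x\<in>nb i. real (d x j) + real (d j k) - real (d x k)) =
      c * (real (d i j) + real (d j k) - real (d i k)) + e j - e k" if "k \<in> V" for k
    using sum_nb_dist[OF assms] sum_nb_dist[OF assms(1) that]
    by (simp add: sum.distrib sum_subtractf c_def e_def distrib_left right_diff_distrib)
  have sum_e: "(\<Sum>k\<in>V. card (nb k) * e k) = 2 * c"
  proof -
    have "(\<Sum>k\<in>V. card (nb k) * e k) = (\<Sum>k\<in>V. if i = k then 2 * real (card (nb k)) else 0)"
      by (intro sum.cong) (auto simp: e_def)
    then show ?thesis using assms finite_V by (simp add: c_def)
  qed
  have "2 * (\<Sum>x\<in>nb i. hit x j) = (\<Sum>x\<in>nb i. \<Sum>k\<in>V. card (nb k) * (real (d x j) + real (d j k) - real (d x k)))"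
    by (simp add: hit_def sum_divide_distrib[symmetric])
  also have "\<dots> = (\<Sum>k\<in>V. card (nb k) * (\<Sum>x\<in>nb i. real (d x j) + real (d j k) - real (d x k)))"
    by (rule trans[OF sum.swap]) (simp only: sum_distrib_left)
  also have "\<dots> = (\<Sum>k\<in>V. c * (card (nb k) * (real (d i j) + real (d j k) - real (d i k)))
      + card (nb k) * e j - card (nb k) * e k)"
    by (intro sum.cong refl) (simp only: inner distrib_left right_diff_distrib mult.left_commute)
  also have "\<dots> = c * (2 * hit i j) + (\<Sum>k\<in>V. real (card (nb k))) * e j - 2 * c"
    by (simp only: sum.distrib sum_subtractf sum_e flip: sum_distrib_left sum_distrib_right) (simp add: hit_def)
  finally have "2 * (\<Sum>x\<in>nb i. hit x j) = 2 * (c * hit i j) + 2 * (N * e j) - 2 * c"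
    using sum_degrees[OF assms(1)] by (simp add: N_def)
  then have "(\<Sum>x\<in>nb i. hit x j) = c * (hit i j - 1) + N * e j"
    by (simp add: algebra_simps)
  then show ?thesis by (simp add: c_def e_def N_def)
qed

text \<open>
  Of the three sums on expanding \<open>hit\<close>, the one with \<open>d i j\<close> and the one with \<open>d i k\<close> cancel by symmetry.
  This is why Kemeny's constant does not depend on the starting vertex \<open>i\<close>.
\<close>

lemma sum_hit_degree:
  assumes "i \<in> V"
  shows "(\<Sum>j\<in>V. hit i j * card (nb j)) = (\<Sum>j\<in>V. \<Sum>k\<in>V. card (nb j) * (card (nb k) * real (d j k))) / 2"
proof -
  have "2 * (\<Sum>j\<in>V. hit i j * card (nb j)) =
     (\<Sum>j\<in>V. \<Sum>k\<in>V. card (nb j) * (card (nb k) * real (d i j))) +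
     (\<Sum>j\<in>V. \<Sum>k\<in>V. card (nb j) * (card (nb k) * real (d j k))) -
     (\<Sum>j\<in>V. \<Sum>k\<in>V. card (nb j) * (card (nb k) * real (d i k)))"
  proof -
    have "2 * (hit i j * card (nb j)) = (\<Sum>k\<in>V. card (nb j) * (card (nb k) * real (d i j))
        + card (nb j) * (card (nb k) * real (d j k)) - card (nb j) * (card (nb k) * real (d i k)))" for j
      by (simp add: hit_def sum_distrib_right) (intro sum.cong refl, simp add: algebra_simps)
    then show ?thesis by (simp only: sum_distrib_left[of 2] sum.distrib sum_subtractf)
  qed
  also have "(\<Sum>j\<in>V. \<Sum>k\<in>V. card (nb j) * (card (nb k) * real (d i k))) =
      (\<Sum>k\<in>V. \<Sum>j\<in>V. card (nb k) * (card (nb j) * real (d i k)))"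
    by (rule trans[OF sum.swap], intro sum.cong refl) (rule mult.left_commute)
  finally show ?thesis by simp
qed

end

section \<open>Geodesics\<close>

locale tree_geodesic = tree_metric +
  fixes c :: "nat \<Rightarrow> 'a" and \<delta> :: nat
  assumes c_in_V: "i \<le> \<delta> \<Longrightarrow> c i \<in> V"
    and d_c: "\<lbrakk>i \<le> \<delta>; j \<le> \<delta>\<rbrakk> \<Longrightarrow> int (d (c i) (c j)) = \<bar>int i - int j\<bar>"

context tree_metric
begin

lemma d_walk_le:
  assumes "\<And>i. i \<le> n \<Longrightarrow> c i \<in> V" "\<And>i. i < n \<Longrightarrow> c (Suc i) \<in> nb (c i)" "i + k \<le> n"
  shows "d (c i) (c (i + k)) \<le> k"
  using assms(3)
proof (induction k)
  case 0
  then show ?case using d_self[OF assms(1)[of i]] by simp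
next
  case (Suc k)
  have "d (c i) (c (Suc (i + k))) \<le> d (c i) (c (i + k)) + d (c (i + k)) (c (Suc (i + k)))"
    using Suc.prems by (intro d_triangle assms(1)) auto
  moreover have "d (c (i + k)) (c (Suc (i + k))) = 1"
    using Suc.prems by (intro d_nb assms) auto
  moreover have "d (c i) (c (i + k)) \<le> k" using Suc by simp
  ultimately show ?case by simp
qed

lemma geodesic_exists:
  assumes "a \<in> V" "b \<in> V"
  obtains c where "tree_geodesic V nb d c (d a b)"
proof -
  have "\<exists>c. c 0 = a \<and> c (d a b) = b \<and> (\<forall>i\<le>d a b. c i \<in> V) \<and> (\<forall>i<d a b. c (Suc i) \<in> nb (c i))"
    using assms(2)
  proof (induction "d a b" arbitrary: b)
    case 0
    then have "a = b" using d_eq_0_iff[OF assms(1) 0(2)] by simp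
    then show ?case using 0 by (intro exI[of _ "\<lambda>_. a"]) (simp add: d_self)
  next
    case (Suc n)
    have "b \<noteq> a" using Suc.hyps(2) d_self[OF assms(1)] by auto
    then obtain p where p: "p \<in> nb b" "d b a = Suc (d p a)"
      using parent_exists[OF Suc.prems assms(1)] by blast
    have pV: "p \<in> V" using p(1) nb_in_V by blast
    have n: "d a p = n" using p(2) Suc.hyps(2) d_commute[OF assms(1)] pV Suc.prems by simp
    then obtain c where c: "c 0 = a" "c n = p" "\<forall>i\<le>n. c i \<in> V" "\<forall>i<n. c (Suc i) \<in> nb (c i)"
      using Suc.hyps(1)[OF _ pV] by auto
    have "b \<in> nb p" using nb_sym[OF Suc.prems p(1)] .
    then have "(c(Suc n := b)) 0 = a \<and> (c(Suc n := b)) (Suc n) = b \<and> (\<forall>i\<le>Suc n. (c(Suc n := b)) i \<in> V)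
       \<and> (\<forall>i<Suc n. (c(Suc n := b)) (Suc i) \<in> nb ((c(Suc n := b)) i))"
      using c Suc.prems by (auto simp: less_Suc_eq le_Suc_eq)
    then show ?case unfolding Suc.hyps(2)[symmetric] by blast
  qed
  then obtain c where c: "c 0 = a" "c (d a b) = b" "\<And>i. i \<le> d a b \<Longrightarrow> c i \<in> V"
      "\<And>i. i < d a b \<Longrightarrow> c (Suc i) \<in> nb (c i)"
    by blast
  have le: "d (c i) (c (i + k)) = k" if "i + k \<le> d a b" for i k
  proof -
    have "d a b \<le> d a (c i) + d (c i) b" using that assms c(3) by (intro d_triangle) auto
    moreover have "d (c i) b \<le> d (c i) (c (i + k)) + d (c (i + k)) b"
      using that assms c(3) by (intro d_triangle) auto
    moreover have "d (c 0) (c (0 + i)) \<le> i"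
      by (rule d_walk_le[of "d a b" c, OF c(3,4)]) (use that in simp_all)
    moreover have "d (c i) (c (i + k)) \<le> k"
      by (rule d_walk_le[of "d a b" c, OF c(3,4)]) (use that in simp_all)
    moreover have "d (c (i + k)) (c ((i + k) + (d a b - (i + k)))) \<le> d a b - (i + k)"
      by (rule d_walk_le[of "d a b" c, OF c(3,4)]) (use that in simp_all)
    ultimately show ?thesis using c(1,2) that by simp
  qed
  have "int (d (c i) (c j)) = \<bar>int i - int j\<bar>" if "i \<le> d a b" "j \<le> d a b" for i j
  proof (cases "i \<le> j")
    case True
    then show ?thesis using le[of i "j - i"] that by simp
  next
    case False
    then show ?thesis using le[of j "i - j"] d_commute[OF c(3) c(3), of i j] that by simp
  qed
  then have "tree_geodesic V nb d c (d a b)"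
    by unfold_locales (use c(3) in auto)
  then show ?thesis by (rule that)
qed

text \<open>
  A walk in a tree that never turns back is a geodesic: at each vertex the previous one is the unique
  neighbour that is closer to the start, so the next one is farther away.
\<close>

lemma nonbacktracking_geodesic:
  assumes cV: "\<And>i. i \<le> n \<Longrightarrow> c i \<in> V"
    and step: "\<And>i. i < n \<Longrightarrow> c (Suc i) \<in> nb (c i)"
    and turn: "\<And>i. Suc (Suc i) \<le> n \<Longrightarrow> c i \<noteq> c (Suc (Suc i))"
  shows "tree_geodesic V nb d c n"
proof -
  have dist: "i + k \<le> n \<Longrightarrow> d (c (i + k)) (c i) = k" for i k
  proof (induction k rule: less_induct)
    case (less k)
    show ?case
    proof (cases k)
      case 0
      then show ?thesis using d_self cV less.prems by simp
    next
      case (Suc k')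
      note k = this
      have V: "c (i + k') \<in> V" "c i \<in> V" "c (i + k) \<in> V" using less.prems Suc cV by auto
      have IH: "d (c (i + k')) (c i) = k'" using less.IH[of k'] less.prems Suc by simp
      have nbk: "c (i + k) \<in> nb (c (i + k'))" using step[of "i + k'"] less.prems Suc by simp
      show ?thesis
      proof (cases k')
        case 0
        then have "d (c i) (c (i + k)) = 1" using d_nb[OF V(2)] nbk by simp
        moreover have "k = 1" using k 0 by simp
        ultimately show ?thesis using d_commute[OF V(2,3)] by metis
      next
        case (Suc k'')
        then have "d (c (i + k'')) (c i) = k''" using less.IH[of k''] less.prems k by simp
        moreover have "c (i + k') \<in> nb (c (i + k''))" using step[of "i + k''"] less.prems k Suc by simp
        then have prev: "c (i + k'') \<in> nb (c (i + k'))" using nb_sym cV less.prems k Suc by simp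
        moreover have "c (i + k'') \<noteq> c (i + k)" using turn[of "i + k''"] less.prems k Suc by simp
        ultimately have "\<not> d (c (i + k)) (c i) \<le> d (c (i + k')) (c i)"
          using parent_unique[OF V(1,2) prev nbk] IH Suc by auto
        then show ?thesis
          using IH k by (rule_tac d_nb_cases[OF V(1) nbk V(2)]) simp_all
      qed
    qed
  qed
  have "int (d (c i) (c j)) = \<bar>int i - int j\<bar>" if "i \<le> n" "j \<le> n" for i j
  proof (cases "i \<le> j")
    case True
    then show ?thesis using dist[of i "j - i"] d_commute[OF cV cV, of i j] that by simp
  next
    case False
    then show ?thesis using dist[of j "i - j"] that by simp
  qed
  then show ?thesis by unfold_locales (use cV in auto)
qed

end

context tree_geodesic
begin

lemma reverse_geodesic: "tree_geodesic V nb d (\<lambda>i. c (\<delta> - i)) \<delta>"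
  by unfold_locales (use c_in_V d_c in auto)

definition off :: "'a set" where
  "off = V - c ` {..\<delta>}"

lemma off_in_V: "u \<in> off \<Longrightarrow> u \<in> V"
  by (simp add: off_def)

lemma finite_off: "finite off"
  by (simp add: off_def finite_V)

lemma inj_c: "inj_on c {..\<delta>}"
proof (rule inj_onI)
  fix i j assume "i \<in> {..\<delta>}" "j \<in> {..\<delta>}" "c i = c j"
  then show "i = j" using d_c[of i j] d_self[OF c_in_V, of i] by simp
qed

lemma card_off: "card V = card off + Suc \<delta>"
proof -
  have "c ` {..\<delta>} \<subseteq> V" using c_in_V by auto
  then have "card V = card (V - c ` {..\<delta>}) + card (c ` {..\<delta>})"
    using finite_V by (metis add.commute card_Diff_subset card_mono finite_subset le_add_diff_inverse)
  then show ?thesis by (simp add: off_def card_image[OF inj_c])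
qed

lemma sum_V_split: "(\<Sum>u\<in>V. f u) = (\<Sum>i\<le>\<delta>. f (c i)) + (\<Sum>u\<in>off. f u)" for f :: "'a \<Rightarrow> int"
proof -
  have "c ` {..\<delta>} \<subseteq> V" using c_in_V by auto
  then have "(\<Sum>u\<in>V. f u) = (\<Sum>u\<in>off. f u) + (\<Sum>u\<in>c ` {..\<delta>}. f u)"
    unfolding off_def by (intro sum.subset_diff) (auto simp: finite_V)
  then show ?thesis by (simp add: sum.reindex[OF inj_c])
qed

text \<open>
  Induction on the distance from \<open>u\<close> to the end \<open>c j\<close>: the next vertex \<open>p\<close> after \<open>u\<close> is on the path, and
  both \<open>u\<close> and its predecessor on the path are neighbours of \<open>p\<close> closer to \<open>c i\<close>.
\<close>

lemma geodesic_unique: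
  assumes "i \<le> j" "j \<le> \<delta>" "u \<in> V" "d u (c i) + d u (c j) = j - i"
  shows "u = c (i + d u (c i))"
  using assms(3,4)
proof (induction "d u (c j)" arbitrary: u)
  case 0
  then have "u = c j" using d_eq_0_iff[of u "c j"] c_in_V assms(2) by simp
  then show ?case using 0 assms(1) by simp
next
  case (Suc n)
  have cV: "c i \<in> V" "c j \<in> V" using assms c_in_V by auto
  have "u \<noteq> c j" using Suc.hyps(2) d_self[OF cV(2)] by auto
  then obtain p where p: "p \<in> nb u" "d u (c j) = Suc (d p (c j))"
    using parent_exists[OF Suc.prems(1) cV(2)] by blast
  have pV: "p \<in> V" using p(1) nb_in_V by blast
  have "int (d (c i) (c j)) = int j - int i" using d_c[of i j] assms by simp
  moreover have "d (c i) (c j) \<le> d p (c i) + d p (c j)"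
    using d_triangle[OF cV(1) pV cV(2)] d_commute[OF cV(1) pV] by simp
  ultimately have "d u (c i) < d p (c i)"
    using Suc.prems p(2) by linarith
  then have pi: "d p (c i) = Suc (d u (c i))"
    using d_nb_cases[OF Suc.prems(1) p(1) cV(1)] by (metis Suc_lessD less_Suc_eq not_less_eq)
  have "p = c (i + d p (c i))"
    using p(2) Suc.hyps(2) Suc.prems(2) pi by (intro Suc.hyps(1)[OF _ pV]) simp_all
  then have pc: "p = c (i + Suc (d u (c i)))" using pi by simp
  let ?m = "i + d u (c i)"
  have m: "Suc ?m \<le> \<delta>" using Suc.prems(2) p(2) assms(1,2) by linarith
  have mV: "c ?m \<in> V" using m c_in_V by simp
  have "int (d p (c ?m)) = 1" "int (d (c ?m) (c i)) = int (d u (c i))"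
    using d_c[of "Suc ?m" ?m] d_c[of ?m i] m assms pc by simp_all
  then have "c ?m \<in> nb p" "d (c ?m) (c i) = d u (c i)" using nb_iff[OF pV mV] by simp_all
  moreover have "u \<in> nb p" using nb_sym[OF Suc.prems(1) p(1)] .
  ultimately show ?case using parent_unique[OF pV cV(1)] pi by simp
qed

text \<open>
  The triangle inequality cannot be an equality, because by uniqueness of geodesics \<open>u\<close> would be on the
  path; and by parity the two sides cannot differ by one.
\<close>

lemma off_detour:
  assumes u: "u \<in> off" and "i \<le> \<delta>" "j \<le> \<delta>"
  shows "\<bar>int i - int j\<bar> + 2 \<le> int (d u (c i)) + int (d u (c j))"
proof -
  have main: "int j - int i + 2 \<le> int (d u (c i)) + int (d u (c j))" if "i \<le> j" "j \<le> \<delta>" for i j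
  proof -
    have V: "u \<in> V" "c i \<in> V" "c j \<in> V" using u that c_in_V by (auto simp: off_def)
    have ij: "int (d (c i) (c j)) = int j - int i" using d_c[of i j] that by simp
    have "d (c i) (c j) \<le> d u (c i) + d u (c j)"
      using d_triangle[OF V(2,1,3)] d_commute[OF V(2,1)] by simp
    moreover have "even (d u (c i) + d (c i) (c j) + d u (c j))" by (rule parity[OF V])
    moreover have "d u (c i) + d u (c j) \<noteq> d (c i) (c j)"
    proof
      assume eq: "d u (c i) + d u (c j) = d (c i) (c j)"
      then have "d u (c i) + d u (c j) = j - i" using ij that by simp
      then have "u = c (i + d u (c i))" "i + d u (c i) \<le> \<delta>"
        using geodesic_unique[OF that V(1)] that by simp_all
      then show False using u unfolding off_def by blast
    qed
    ultimately show ?thesis using ij by presburger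
  qed
  show ?thesis using main[of i j] main[of j i] assms by (cases "i \<le> j") simp_all
qed

definition path_sum :: "'a \<Rightarrow> int" where
  "path_sum u = (\<Sum>i\<le>\<delta>. int (d u (c i)))"

definition path_sum_bound :: int where
  "path_sum_bound = (\<Sum>i\<le>\<delta>. \<bar>2 * int i - int \<delta>\<bar> + 2)"

lemma double_path_sum: "2 * path_sum u = (\<Sum>i\<le>\<delta>. int (d u (c i)) + int (d u (c (\<delta> - i))))"
  unfolding path_sum_def
  by (simp only: sum.distrib sum_reflect[of "\<lambda>i. int (d u (c i))"] mult_2)

lemma off_detour_mirror:
  assumes "u \<in> off" "i \<le> \<delta>"
  shows "\<bar>2 * int i - int \<delta>\<bar> + 2 \<le> int (d u (c i)) + int (d u (c (\<delta> - i)))"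
  using off_detour[OF assms, of "\<delta> - i"] assms(2) by simp

lemma path_sum_ge:
  assumes "u \<in> off"
  shows "path_sum_bound \<le> 2 * path_sum u"
  unfolding path_sum_bound_def double_path_sum
  using off_detour_mirror[OF assms] by (intro sum_mono) simp

text \<open>
  In the case of equality the detour inequality is tight for every mirror pair \<open>i, \<delta> - i\<close>; the innermost
  pair, at distance at most one, leaves room only for a neighbour of one of its two vertices.
\<close>

lemma path_sum_eq_imp_central:
  assumes u: "u \<in> off" and eq: "2 * path_sum u = path_sum_bound"
  shows "u \<in> nb (c (\<delta> div 2)) \<or> u \<in> nb (c (\<delta> - \<delta> div 2))"
proof -
  have "(\<Sum>i\<le>\<delta>. (int (d u (c i)) + int (d u (c (\<delta> - i)))) - (\<bar>2 * int i - int \<delta>\<bar> + 2)) = 0"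
    using eq unfolding path_sum_bound_def double_path_sum sum_subtractf by simp
  then have "\<forall>i\<in>{..\<delta>}. (int (d u (c i)) + int (d u (c (\<delta> - i)))) - (\<bar>2 * int i - int \<delta>\<bar> + 2) = 0"
    using off_detour_mirror[OF u] by (subst (asm) sum_nonneg_eq_0_iff) simp_all
  then have mid: "int (d u (c (\<delta> div 2))) + int (d u (c (\<delta> - \<delta> div 2))) = \<bar>2 * int (\<delta> div 2) - int \<delta>\<bar> + 2"
    by (auto dest: bspec[of _ _ "\<delta> div 2"])
  have V: "u \<in> V" "c (\<delta> div 2) \<in> V" "c (\<delta> - \<delta> div 2) \<in> V" using u c_in_V by (auto simp: off_def)
  have "u \<noteq> c (\<delta> div 2)" "u \<noteq> c (\<delta> - \<delta> div 2)" using u by (auto simp: off_def)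
  then have "d u (c (\<delta> div 2)) \<noteq> 0" "d u (c (\<delta> - \<delta> div 2)) \<noteq> 0"
    using d_eq_0_iff V by auto
  moreover have "\<bar>2 * int (\<delta> div 2) - int \<delta>\<bar> \<le> 1" by linarith
  ultimately have "d u (c (\<delta> div 2)) = 1 \<or> d u (c (\<delta> - \<delta> div 2)) = 1"
    using mid by linarith
  then show ?thesis using nb_iff d_commute V by metis
qed

text \<open>
  Removing the edge between \<open>u\<close> and \<open>v\<close> leaves the whole path on one side, because the edge is not an
  edge of the path. The induction along the path makes this explicit: if the edge were crossed between
  \<open>c i\<close> and \<open>c (Suc i)\<close>, then \<open>c i\<close> would have two neighbours that are not farther from \<open>v\<close>.
\<close>

lemma path_sum_child:
  assumes u: "u \<in> off" and v: "v \<in> off" "u \<in> nb v" and closer: "d u (c 0) < d v (c 0)"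
  shows "path_sum v = path_sum u + int \<delta> + 1"
proof -
  have V: "u \<in> V" "v \<in> V" using u v by (auto simp: off_def)
  have "v \<in> nb u" using nb_sym V v by blast
  have step: "d v (c i) = Suc (d u (c i))" if "i \<le> \<delta>" for i
    using that
  proof (induction i)
    case 0
    show ?case using closer by (rule_tac d_nb_cases[OF V(2) v(2) c_in_V[of 0]]) auto
  next
    case (Suc i)
    let ?x = "c i" and ?y = "c (Suc i)"
    have xy: "?x \<in> V" "?y \<in> V" using c_in_V Suc.prems by auto
    have IH: "d v ?x = Suc (d u ?x)" using Suc by simp
    show ?case
    proof (rule ccontr)
      assume neq: "d v ?y \<noteq> Suc (d u ?y)"
      have uy: "d u ?y = Suc (d v ?y)"
        using d_nb_cases[OF V(2) v(2) xy(2)] neq by metis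
      have "int (d ?x ?y) = 1" using d_c[of i "Suc i"] Suc.prems by simp
      then have y: "?y \<in> nb ?x" using nb_iff[OF xy] by simp
      have dist: "d ?y v \<le> d ?x v" "d ?y u = Suc (d ?x u)"
      proof -
        have "d ?y u \<le> Suc (d ?x u)"
          using d_triangle[OF xy(2,1) V(1)] d_nb[OF xy(1) y] d_commute[OF xy] by simp
        moreover have "d v ?x \<le> Suc (d ?y v)"
          using d_triangle[OF xy V(2)] d_nb[OF xy(1) y] d_commute[OF V(2) xy(1)] by simp
        ultimately show "d ?y v \<le> d ?x v" "d ?y u = Suc (d ?x u)"
          using IH uy d_commute[OF V(1) xy(1)] d_commute[OF V(1) xy(2)]
            d_commute[OF V(2) xy(1)] d_commute[OF V(2) xy(2)] by linarith+
      qed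
      \<comment> \<open>the neighbour \<open>w\<close> of \<open>?x\<close> towards \<open>u\<close> competes with \<open>?y\<close>\<close>
      have "?x \<noteq> u" using u Suc.prems by (auto simp: off_def)
      then obtain w where w: "w \<in> nb ?x" "d ?x u = Suc (d w u)"
        using parent_exists[OF xy(1) V(1)] by blast
      have wV: "w \<in> V" using w(1) nb_in_V by blast
      have "d w v \<le> d w u + d u v" by (rule d_triangle[OF wV V])
      moreover have "d u v = 1" using d_nb[OF V(1) \<open>v \<in> nb u\<close>] .
      moreover have "d ?x v = Suc (d ?x u)" using IH d_commute[OF V(1) xy(1)] d_commute[OF V(2) xy(1)] by simp
      ultimately have "d w v \<le> d ?x v" using w(2) by simp
      then have "w = ?y" using parent_unique[OF xy(1) V(2) w(1) y] dist(1) by blast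
      then show False using w(2) dist(2) by simp
    qed
  qed
  have "path_sum v = (\<Sum>i\<le>\<delta>. int (d u (c i)) + 1)"
    unfolding path_sum_def using step by (intro sum.cong) auto
  then show ?thesis by (simp add: path_sum_def sum.distrib)
qed

end

section \<open>The least sum of distances for a given diameter\<close>

text \<open>
  The sum of the distances of all ordered pairs of vertices in the caterpillar whose spine has \<open>\<delta> + 1\<close>
  vertices and whose \<open>r\<close> leaves are attached to the centre of the spine. The three summands come from
  pairs on the spine, pairs of a spine vertex and a leaf, and pairs of leaves.
\<close>

definition min_dist_sum :: "nat \<Rightarrow> nat \<Rightarrow> int" where
  "min_dist_sum \<delta> r = (\<Sum>i\<le>\<delta>. \<Sum>j\<le>\<delta>. \<bar>int i - int j\<bar>) +
     int r * (\<Sum>i\<le>\<delta>. \<bar>2 * int i - int \<delta>\<bar> + 2) + 2 * int r * (int r - 1)"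

lemma six_min_dist_sum:
  "6 * min_dist_sum \<delta> r = 2 * int \<delta> * (int \<delta> + 1) * (int \<delta> + 2) +
    3 * int r * ((if even \<delta> then int \<delta> * (int \<delta> + 2) else (int \<delta> + 1)\<^sup>2) + 4 * (int \<delta> + 1)) +
    12 * int r * (int r - 1)"
proof -
  define P where "P = (\<Sum>i\<le>\<delta>. \<Sum>j\<le>\<delta>. \<bar>int i - int j\<bar>)"
  define Q where "Q = (\<Sum>i\<le>\<delta>. \<bar>2 * int i - int \<delta>\<bar>)"
  define A where "A = (if even \<delta> then int \<delta> * (int \<delta> + 2) else (int \<delta> + 1)\<^sup>2)"
  have P: "3 * P = int \<delta> * (int \<delta> + 1) * (int \<delta> + 2)" unfolding P_def by (rule sum_abs_diff)
  have Q: "2 * Q = A" unfolding Q_def A_def by (rule sum_abs_reflect)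
  have "min_dist_sum \<delta> r = P + int r * (Q + 2 * (int \<delta> + 1)) + 2 * int r * (int r - 1)"
    by (simp add: min_dist_sum_def P_def Q_def sum.distrib)
  then have "6 * min_dist_sum \<delta> r = 2 * (3 * P) + 3 * int r * (2 * Q + 4 * (int \<delta> + 1)) + 12 * int r * (int r - 1)"
    by (simp add: algebra_simps)
  then show ?thesis unfolding P Q A_def[symmetric] by (simp only: mult.assoc)
qed

text \<open>
  By \<open>kemeny_eq\<close> below, the left-hand side is Kemeny's constant of a tree of order \<open>n\<close> whose distances add
  up to the minimum.
\<close>

lemma min_kemeny_closed_form:
  fixes n \<delta> r :: nat
  defines "N \<equiv> real n" and "d \<equiv> real \<delta>"
  assumes n: "n = r + Suc \<delta>" and "0 < \<delta>"
  shows "odd \<delta> \<Longrightarrow> real_of_int (min_dist_sum \<delta> r) / (N - 1) - (2 * N - 1) / 2 = 1 / (N - 1) *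
      (N * d ^ 2 / 2 - d ^ 3 / 6 + N ^ 2 - N * d - d ^ 2 / 2 - 2 * N + 7 / 6 * d + 1)"
    and "even \<delta> \<Longrightarrow> real_of_int (min_dist_sum \<delta> r) / (N - 1) - (2 * N - 1) / 2 = 1 / (N - 1) *
      (N * d ^ 2 / 2 - d ^ 3 / 6 + N ^ 2 - N * d - d ^ 2 / 2 - 5 / 2 * N + 5 / 3 * d + 3 / 2)"
proof -
  define m where "m = real_of_int (min_dist_sum \<delta> r)"
  have r: "real r = N - d - 1" and N1: "N - 1 \<noteq> 0"
    using assms by auto
  have "real_of_int (6 * min_dist_sum \<delta> r) = 2 * d * (d + 1) * (d + 2) +
    3 * real r * ((if even \<delta> then d * (d + 2) else (d + 1)\<^sup>2) + 4 * (d + 1)) +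
    12 * real r * (real r - 1)"
    unfolding six_min_dist_sum d_def by simp
  then have m: "6 * m = 2 * d * (d + 1) * (d + 2) +
    3 * (N - d - 1) * ((if even \<delta> then d * (d + 2) else (d + 1)\<^sup>2) + 4 * (d + 1)) +
    12 * (N - d - 1) * (N - d - 1 - 1)"
    unfolding r m_def by simp
  have divide: "x / y - q / 2 = 1 / y * b" if "6 * x - 3 * q * y = 6 * b" "y \<noteq> 0" for x y q b :: real
  proof -
    have "x = b + q * y / 2" using that(1) by (simp add: mult.assoc)
    then show ?thesis using that(2) by (simp add: add_divide_distrib)
  qed
  note eq = divide[OF _ N1, of m "2 * N - 1"]
  show "m / (N - 1) - (2 * N - 1) / 2 = 1 / (N - 1) *
      (N * d ^ 2 / 2 - d ^ 3 / 6 + N ^ 2 - N * d - d ^ 2 / 2 - 2 * N + 7 / 6 * d + 1)" if "odd \<delta>"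
    using that by (intro eq) (simp add: m, simp add: algebra_simps power2_eq_square power3_eq_cube)
  show "m / (N - 1) - (2 * N - 1) / 2 = 1 / (N - 1) *
      (N * d ^ 2 / 2 - d ^ 3 / 6 + N ^ 2 - N * d - d ^ 2 / 2 - 5 / 2 * N + 5 / 3 * d + 3 / 2)" if "even \<delta>"
    using that by (intro eq) (simp add: m, simp add: algebra_simps power2_eq_square power3_eq_cube)
qed

context tree_geodesic
begin

lemma dist_sum_split:
  "(\<Sum>u\<in>V. \<Sum>v\<in>V. int (d u v)) = (\<Sum>i\<le>\<delta>. \<Sum>j\<le>\<delta>. \<bar>int i - int j\<bar>) +
     2 * (\<Sum>u\<in>off. path_sum u) + (\<Sum>u\<in>off. \<Sum>v\<in>off. int (d u v))"
proof -
  have "(\<Sum>u\<in>V. \<Sum>v\<in>V. int (d u v)) = (\<Sum>u\<in>V. (\<Sum>j\<le>\<delta>. int (d u (c j))) + (\<Sum>v\<in>off. int (d u v)))"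
    by (simp only: sum_V_split)
  also have "\<dots> = (\<Sum>u\<in>V. \<Sum>j\<le>\<delta>. int (d u (c j))) + (\<Sum>u\<in>V. \<Sum>v\<in>off. int (d u v))"
    by (rule sum.distrib)
  also have "\<dots> = ((\<Sum>i\<le>\<delta>. \<Sum>j\<le>\<delta>. int (d (c i) (c j))) + (\<Sum>u\<in>off. path_sum u))
      + ((\<Sum>i\<le>\<delta>. \<Sum>v\<in>off. int (d (c i) v)) + (\<Sum>u\<in>off. \<Sum>v\<in>off. int (d u v)))"
    by (simp only: sum_V_split path_sum_def)
  also have "(\<Sum>i\<le>\<delta>. \<Sum>v\<in>off. int (d (c i) v)) = (\<Sum>v\<in>off. \<Sum>i\<le>\<delta>. int (d (c i) v))"
    by (rule sum.swap)
  also have "\<dots> = (\<Sum>u\<in>off. path_sum u)"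
    unfolding path_sum_def using d_commute c_in_V off_in_V by (intro sum.cong refl) auto
  also have "(\<Sum>i\<le>\<delta>. \<Sum>j\<le>\<delta>. int (d (c i) (c j))) = (\<Sum>i\<le>\<delta>. \<Sum>j\<le>\<delta>. \<bar>int i - int j\<bar>)"
    using d_c by (intro sum.cong refl) auto
  finally show ?thesis by simp
qed

text \<open>
  An edge between two vertices off the path, oriented away from the path.
\<close>

definition parent_off :: "'a \<Rightarrow> 'a \<Rightarrow> bool" where
  "parent_off u v \<longleftrightarrow> u \<in> off \<and> v \<in> off \<and> u \<in> nb v \<and> d u (c 0) < d v (c 0)"

definition num_parents :: "'a \<Rightarrow> int" where
  "num_parents v = (\<Sum>u\<in>off. of_bool (parent_off u v))"

lemma adjacent_off:
  assumes "u \<in> off" "v \<in> off"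
  shows "(of_bool (v \<in> nb u) :: int) = of_bool (parent_off u v) + of_bool (parent_off v u)"
proof (cases "v \<in> nb u")
  case True
  have V: "u \<in> V" "v \<in> V" "c 0 \<in> V" using assms off_in_V c_in_V by auto
  have "u \<in> nb v" using nb_sym[OF V(1) True] .
  then show ?thesis
    using True assms by (rule_tac d_nb_cases[OF V(1) True V(3)]) (simp_all add: parent_off_def)
next
  case False
  then have "u \<notin> nb v" using nb_sym assms off_in_V by blast
  then show ?thesis using False by (simp add: parent_off_def)
qed

lemma count_adjacent_off:
  "(\<Sum>u\<in>off. \<Sum>v\<in>off. of_bool (v \<in> nb u) :: int) = 2 * (\<Sum>v\<in>off. num_parents v)"
proof -
  have "(\<Sum>u\<in>off. \<Sum>v\<in>off. of_bool (v \<in> nb u) :: int) =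
      (\<Sum>u\<in>off. \<Sum>v\<in>off. of_bool (parent_off u v) + of_bool (parent_off v u))"
    by (intro sum.cong refl adjacent_off)
  also have "\<dots> = (\<Sum>u\<in>off. \<Sum>v\<in>off. of_bool (parent_off u v)) + (\<Sum>u\<in>off. num_parents u)"
    by (simp only: sum.distrib num_parents_def)
  also have "(\<Sum>u\<in>off. \<Sum>v\<in>off. of_bool (parent_off u v) :: int) = (\<Sum>v\<in>off. num_parents v)"
    unfolding num_parents_def by (rule sum.swap)
  finally show ?thesis by simp
qed

lemma num_parents_nonneg: "0 \<le> num_parents v"
  unfolding num_parents_def by (intro sum_nonneg) simp

text \<open>
  The parent of \<open>v\<close> satisfies the basic bound, and \<open>v\<close> is farther than its parent from each of the
  \<open>\<delta> + 1 \<ge> 2\<close> path vertices. The factor 4 is twice what is needed to pay for the edge from \<open>v\<close> to its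
  parent, which lowers the sum of distances by 2; the surplus excludes such edges in the case of
  equality.
\<close>

lemma path_sum_ge_parents:
  assumes "0 < \<delta>" and v: "v \<in> off"
  shows "path_sum_bound + 4 * num_parents v \<le> 2 * path_sum v"
proof (cases "\<exists>u. parent_off u v")
  case False
  then have "num_parents v = 0" by (simp add: num_parents_def)
  then show ?thesis using path_sum_ge[OF v] by simp
next
  case True
  then obtain u where u: "parent_off u v" by blast
  have V: "v \<in> V" "c 0 \<in> V" using v off_in_V c_in_V by auto
  have "parent_off x v \<longleftrightarrow> x = u" for x
    using u parent_unique[OF V, of x u] by (auto simp: parent_off_def)
  then have "num_parents v = (\<Sum>x\<in>off. of_bool (x = u))"
    by (simp only: num_parents_def)
  also have "\<dots> = 1" using u finite_off by (simp add: parent_off_def of_bool_def)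
  finally have 1: "num_parents v = 1" .
  have "path_sum v = path_sum u + int \<delta> + 1"
    using u by (intro path_sum_child) (simp_all add: parent_off_def)
  moreover have "path_sum_bound \<le> 2 * path_sum u"
    using u by (intro path_sum_ge) (simp add: parent_off_def)
  ultimately show ?thesis using 1 assms(1) by simp
qed

lemma d_off_ge:
  assumes "u \<in> off" "v \<in> off"
  shows "2 - 2 * of_bool (u = v) - of_bool (v \<in> nb u) \<le> int (d u v)"
proof -
  have "u \<in> V" "v \<in> V" using assms off_in_V by auto
  then show ?thesis using d_eq_0_iff[of u v] nb_iff[of u v] by (cases "d u v") auto
qed

text \<open>
  The deviation from the minimum as a sum of terms each of which is nonnegative. The correction
  \<open>num_parents\<close> in the first sum is compensated by the indicator of adjacency in the second.
\<close>

lemma dist_sum_excess: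
  "(\<Sum>u\<in>V. \<Sum>v\<in>V. int (d u v)) = min_dist_sum \<delta> (card off) +
     (\<Sum>v\<in>off. 2 * path_sum v - path_sum_bound - 2 * num_parents v) +
     (\<Sum>u\<in>off. \<Sum>v\<in>off. int (d u v) - (2 - 2 * of_bool (u = v) - of_bool (v \<in> nb u)))"
proof -
  have diag: "(\<Sum>v\<in>off. of_bool (u = v) :: int) = 1" if "u \<in> off" for u
    using that finite_off by (simp add: of_bool_def)
  have "(\<Sum>u\<in>off. \<Sum>v\<in>off. int (d u v) - (2 - 2 * of_bool (u = v) - of_bool (v \<in> nb u))) =
      (\<Sum>u\<in>off. \<Sum>v\<in>off. int (d u v)) - (\<Sum>u\<in>off. \<Sum>v\<in>off. 2)
      + 2 * (\<Sum>u\<in>off. \<Sum>v\<in>off. of_bool (u = v)) + (\<Sum>u\<in>off. \<Sum>v\<in>off. of_bool (v \<in> nb u))"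
    by (simp only: sum_subtractf sum_distrib_left)
  also have "(\<Sum>u\<in>off. \<Sum>v\<in>off. of_bool (u = v) :: int) = int (card off)"
    by (simp add: diag cong: sum.cong)
  finally have "(\<Sum>u\<in>off. \<Sum>v\<in>off. int (d u v) - (2 - 2 * of_bool (u = v) - of_bool (v \<in> nb u))) =
      (\<Sum>u\<in>off. \<Sum>v\<in>off. int (d u v)) - 2 * int (card off) * (int (card off) - 1)
      + 2 * (\<Sum>v\<in>off. num_parents v)"
    by (simp add: count_adjacent_off right_diff_distrib)
  moreover have "(\<Sum>v\<in>off. 2 * path_sum v - path_sum_bound - 2 * num_parents v) =
      2 * (\<Sum>v\<in>off. path_sum v) - int (card off) * path_sum_bound - 2 * (\<Sum>v\<in>off. num_parents v)"
    by (simp only: sum_subtractf sum_distrib_left sum_constant)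
  ultimately show ?thesis
    unfolding dist_sum_split min_dist_sum_def path_sum_bound_def[symmetric] by simp
qed

lemma dist_sum_ge:
  assumes "0 < \<delta>"
  shows "min_dist_sum \<delta> (card off) \<le> (\<Sum>u\<in>V. \<Sum>v\<in>V. int (d u v))"
proof -
  have "0 \<le> (\<Sum>v\<in>off. 2 * path_sum v - path_sum_bound - 2 * num_parents v)"
  proof (rule sum_nonneg)
    fix v assume "v \<in> off"
    then show "0 \<le> 2 * path_sum v - path_sum_bound - 2 * num_parents v"
      using path_sum_ge_parents[OF assms, of v] num_parents_nonneg[of v] by linarith
  qed
  moreover have "0 \<le> (\<Sum>u\<in>off. \<Sum>v\<in>off. int (d u v) - (2 - 2 * of_bool (u = v) - of_bool (v \<in> nb u)))"
    using d_off_ge by (intro sum_nonneg) simp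
  ultimately show ?thesis unfolding dist_sum_excess by linarith
qed

text \<open>
  All terms of \<open>dist_sum_excess\<close> vanish. So vertices off the path are pairwise at distance 2, and each is
  a neighbour of one of the two central vertices (which coincide for even \<open>\<delta>\<close>). Neighbours of distinct
  central vertices would be at distance 3, so one central vertex serves all of them.
\<close>

lemma dist_sum_eq_imp_hub:
  assumes "0 < \<delta>" and eq: "(\<Sum>u\<in>V. \<Sum>v\<in>V. int (d u v)) = min_dist_sum \<delta> (card off)"
  shows "off \<subseteq> nb (c (\<delta> div 2)) \<or> off \<subseteq> nb (c (\<delta> - \<delta> div 2))"
proof -
  have nn1: "0 \<le> 2 * path_sum v - path_sum_bound - 2 * num_parents v" if "v \<in> off" for v
    using path_sum_ge_parents[OF assms(1) that] num_parents_nonneg[of v] by linarith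
  have nn2: "0 \<le> int (d u v) - (2 - 2 * of_bool (u = v) - of_bool (v \<in> nb u))"
    if "u \<in> off" "v \<in> off" for u v
    using d_off_ge[OF that] by simp
  have s1: "0 \<le> (\<Sum>v\<in>off. 2 * path_sum v - path_sum_bound - 2 * num_parents v)"
    by (intro sum_nonneg nn1)
  have s2: "0 \<le> (\<Sum>u\<in>off. \<Sum>v\<in>off. int (d u v) - (2 - 2 * of_bool (u = v) - of_bool (v \<in> nb u)))"
    by (intro sum_nonneg nn2)
  have z: "(\<Sum>v\<in>off. 2 * path_sum v - path_sum_bound - 2 * num_parents v) = 0"
    "(\<Sum>u\<in>off. \<Sum>v\<in>off. int (d u v) - (2 - 2 * of_bool (u = v) - of_bool (v \<in> nb u))) = 0"
    using s1 s2 eq unfolding dist_sum_excess by linarith+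
  have "2 * path_sum v - path_sum_bound - 2 * num_parents v = 0" if "v \<in> off" for v
    using z(1) that nn1 finite_off by (subst (asm) sum_nonneg_eq_0_iff) auto
  then have tight: "2 * path_sum v = path_sum_bound" "num_parents v = 0" if "v \<in> off" for v
    using path_sum_ge_parents[OF assms(1) that] num_parents_nonneg[of v] that by fastforce+
  have row: "(\<Sum>v\<in>off. int (d u v) - (2 - 2 * of_bool (u = v) - of_bool (v \<in> nb u))) = 0" if "u \<in> off" for u
    using z(2) that nn2 finite_off by (subst (asm) sum_nonneg_eq_0_iff) (auto intro: sum_nonneg)
  have dist: "int (d u v) = 2 - 2 * of_bool (u = v) - of_bool (v \<in> nb u)" if "u \<in> off" "v \<in> off" for u v
    using bspec[OF iffD1[OF sum_nonneg_eq_0_iff[OF finite_off nn2[OF that(1)]] row[OF that(1)]] that(2)]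
    by linarith
  have "\<not> parent_off u v" for u v
  proof
    assume p: "parent_off u v"
    then have "(\<Sum>x\<in>off. of_bool (parent_off x v) :: int) = 0"
      using tight(2)[of v] by (simp add: num_parents_def parent_off_def)
    then have "\<forall>x\<in>off. of_bool (parent_off x v) = (0::int)"
      using finite_off by (subst (asm) sum_nonneg_eq_0_iff) auto
    then show False using p by (auto simp: parent_off_def)
  qed
  then have "(of_bool (v \<in> nb u) :: int) = 0" if "u \<in> off" "v \<in> off" for u v
    using adjacent_off[OF that] by simp
  then have d2: "d u v = 2" if "u \<in> off" "v \<in> off" "u \<noteq> v" for u v
    using dist[OF that(1,2)] that by simp
  let ?x = "c (\<delta> div 2)" and ?y = "c (\<delta> - \<delta> div 2)"
  show ?thesis
  proof (rule ccontr)
    assume "\<not> ?thesis"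
    then obtain u v where uv: "u \<in> off" "u \<notin> nb ?y" "v \<in> off" "v \<notin> nb ?x" by blast
    have adj: "u \<in> nb ?x" "v \<in> nb ?y"
      using uv path_sum_eq_imp_central tight(1) by blast+
    have "u \<noteq> v" using adj uv by blast
    have xy: "?x \<noteq> ?y" using adj uv by metis
    have V: "u \<in> V" "v \<in> V" "?x \<in> V" "?y \<in> V" using uv off_in_V c_in_V by auto
    have "\<delta> div 2 \<noteq> \<delta> - \<delta> div 2" using xy by metis
    then have "\<bar>int (\<delta> div 2) - int (\<delta> - \<delta> div 2)\<bar> = 1" by linarith
    then have dxy: "d ?x ?y = 1" using d_c[of "\<delta> div 2" "\<delta> - \<delta> div 2"] by simp
    have "d ?y u \<noteq> 1" using uv(2) nb_iff V by blast
    moreover have "d ?y u \<noteq> 0" using uv(1) d_eq_0_iff[OF V(4,1)] by (auto simp: off_def)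
    ultimately have yu: "2 \<le> d ?y u" by simp
    \<comment> \<open>\<open>?x\<close> and \<open>v\<close> are neighbours of \<open>?y\<close> that are not farther from \<open>u\<close> than \<open>?y\<close>\<close>
    have "?x \<in> nb ?y" using dxy nb_iff V d_commute by metis
    moreover have "d ?x u = 1" using d_nb[OF V(3) adj(1)] .
    moreover have "d v u = 2" using d2 uv \<open>u \<noteq> v\<close> by blast
    ultimately have "?x = v" using parent_unique[OF V(4,1) _ adj(2)] yu by simp
    then show False using uv(3) by (auto simp: off_def)
  qed
qed

lemma dist_sum_hub:
  assumes "off \<subseteq> nb (c (\<delta> div 2))"
  shows "(\<Sum>u\<in>V. \<Sum>v\<in>V. int (d u v)) \<le> min_dist_sum \<delta> (card off)"
proof -
  let ?x = "c (\<delta> div 2)"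
  have x: "?x \<in> V" using c_in_V by simp
  have one: "d u ?x = 1" "d ?x u = 1" if "u \<in> off" for u
    using d_nb[OF x] d_commute[OF x] assms that off_in_V by force+
  have ps: "2 * path_sum u \<le> path_sum_bound" if u: "u \<in> off" for u
  proof -
    have "path_sum u \<le> (\<Sum>i\<le>\<delta>. \<bar>int i - int (\<delta> div 2)\<bar> + 1)"
      unfolding path_sum_def
    proof (rule sum_mono)
      fix i assume i: "i \<in> {..\<delta>}"
      have "d u (c i) \<le> d u ?x + d ?x (c i)" using i by (intro d_triangle off_in_V u c_in_V) auto
      then show "int (d u (c i)) \<le> \<bar>int i - int (\<delta> div 2)\<bar> + 1"
        using d_c[of "\<delta> div 2" i] one(1)[OF u] i by auto
    qed
    then show ?thesis
      using sum_abs_centre[of \<delta>] by (simp add: path_sum_bound_def sum.distrib)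
  qed
  have pairs: "int (d u v) \<le> 2 - 2 * of_bool (u = v)" if "u \<in> off" "v \<in> off" for u v
    using d_triangle[OF off_in_V x off_in_V, OF that] one[OF that(1)] one[OF that(2)] d_self off_in_V that
    by auto
  have "(\<Sum>u\<in>off. \<Sum>v\<in>off. int (d u v)) \<le> (\<Sum>u\<in>off. \<Sum>v\<in>off. 2 - 2 * of_bool (u = v))"
    by (intro sum_mono pairs)
  also have "\<dots> = (\<Sum>u\<in>off. 2 * int (card off) - 2)"
    using finite_off by (intro sum.cong refl) (simp add: sum_subtractf of_bool_def flip: sum_distrib_left)
  finally have "(\<Sum>u\<in>off. \<Sum>v\<in>off. int (d u v)) \<le> 2 * int (card off) * (int (card off) - 1)"
    by (simp add: right_diff_distrib)
  moreover have "(\<Sum>u\<in>off. 2 * path_sum u) \<le> (\<Sum>u\<in>off. path_sum_bound)"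
    by (intro sum_mono ps)
  then have "2 * (\<Sum>u\<in>off. path_sum u) \<le> int (card off) * path_sum_bound"
    by (simp flip: sum_distrib_left)
  ultimately show ?thesis
    unfolding dist_sum_split min_dist_sum_def path_sum_bound_def[symmetric] by linarith
qed

lemma path_adjacent_iff:
  assumes "i \<le> \<delta>" "j \<le> \<delta>"
  shows "c j \<in> nb (c i) \<longleftrightarrow> j = Suc i \<or> i = Suc j"
proof -
  have "c j \<in> nb (c i) \<longleftrightarrow> int (d (c i) (c j)) = 1"
    using nb_iff[OF c_in_V c_in_V, OF assms] by simp
  also have "\<dots> \<longleftrightarrow> j = Suc i \<or> i = Suc j"
    unfolding d_c[OF assms] by linarith
  finally show ?thesis .
qed

lemma hub_adjacent_iff:
  assumes hub: "off \<subseteq> nb (c (\<delta> div 2))" and u: "u \<in> off" and i: "i \<le> \<delta>"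
  shows "u \<in> nb (c i) \<longleftrightarrow> i = \<delta> div 2"
proof
  assume "u \<in> nb (c i)"
  then have "d u (c i) = 1" using d_nb d_commute off_in_V u c_in_V i by metis
  moreover have "d u (c (\<delta> div 2)) = 1"
    using d_nb[of "c (\<delta> div 2)" u] d_commute[of u "c (\<delta> div 2)"] off_in_V[OF u] c_in_V[of "\<delta> div 2"] hub u
    by auto
  ultimately show "i = \<delta> div 2" using off_detour[OF u i, of "\<delta> div 2"] by simp
qed (use hub u in blast)

lemma off_not_adjacent:
  assumes hub: "off \<subseteq> nb (c (\<delta> div 2))" and "u \<in> off" "v \<in> off"
  shows "v \<notin> nb u"
proof
  assume v: "v \<in> nb u"
  let ?x = "c (\<delta> div 2)"
  have V: "u \<in> V" "v \<in> V" "?x \<in> V" using assms off_in_V c_in_V by auto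
  have "d ?x u = 1" "d ?x v = 1" using assms d_nb[OF V(3)] by blast+
  moreover have "d u v = 1" by (rule d_nb[OF V(1) v])
  ultimately show False using parity[OF V(3,1,2)] by simp
qed

end

section \<open>The metric of an undirected tree\<close>

locale tree_graph =
  fixes T :: "'a pair_pre_digraph"
  assumes tree: "undirected_tree T"
begin

lemma pair_graph_T: "pair_graph T"
  using tree by (simp add: undirected_tree_def)

interpretation pair_graph T by (rule pair_graph_T)

lemma verts_nonempty: "pverts T \<noteq> {}"
  using tree by (auto simp: undirected_tree_def connected_conv)

lemma walk_exists:
  assumes "u \<in> pverts T" "v \<in> pverts T"
  shows "\<exists>p. awalk u p v"
proof -
  have "strongly_connected (with_proj T)"
    using tree sym_arcs by (intro symmetric_connected_imp_strongly_connected) (auto simp: undirected_tree_def)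
  then show ?thesis using assms by (auto simp: strongly_connected_def reachable_awalk)
qed

lemma graph_dist_le: "awalk u p v \<Longrightarrow> graph_dist T u v \<le> length p"
  unfolding graph_dist_def by (rule Least_le) blast

lemma shortest_walk:
  assumes "u \<in> pverts T" "v \<in> pverts T"
  obtains p where "awalk u p v" "length p = graph_dist T u v"
proof -
  have "\<exists>k p. awalk u p v \<and> length p = k" using walk_exists[OF assms] by blast
  from LeastI_ex[OF this] show ?thesis using that unfolding graph_dist_def by blast
qed

lemma length_rev_path: "length (rev_path p) = length p"
  by (induction p) auto

lemma graph_dist_le_swap:
  assumes "u \<in> pverts T" "v \<in> pverts T"
  shows "graph_dist T u v \<le> graph_dist T v u"
proof -
  obtain p where p: "awalk v p u" "length p = graph_dist T v u" using shortest_walk[OF assms(2,1)] .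
  then show ?thesis using graph_dist_le[of u "rev_path p" v] by (simp add: length_rev_path)
qed

lemma graph_dist_triangle:
  assumes "u \<in> pverts T" "v \<in> pverts T" "w \<in> pverts T"
  shows "graph_dist T u w \<le> graph_dist T u v + graph_dist T v w"
proof -
  obtain p where p: "awalk u p v" "length p = graph_dist T u v" using shortest_walk[OF assms(1,2)] .
  obtain q where q: "awalk v q w" "length q = graph_dist T v w" using shortest_walk[OF assms(2,3)] .
  show ?thesis using graph_dist_le[OF awalk_appendI[OF p(1) q(1)]] p(2) q(2) by simp
qed

lemma graph_dist_eq_0_iff:
  assumes "u \<in> pverts T" "v \<in> pverts T"
  shows "graph_dist T u v = 0 \<longleftrightarrow> u = v"
proof
  assume "graph_dist T u v = 0"
  moreover obtain p where "awalk u p v" "length p = graph_dist T u v" using shortest_walk[OF assms] .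
  ultimately show "u = v" using awalk_empty_ends by auto
next
  assume "u = v"
  then show "graph_dist T u v = 0" using graph_dist_le[of u "[]" v] assms by (simp add: awalk_Nil_iff)
qed

lemma arc_awalk: "(u, v) \<in> parcs T \<Longrightarrow> awalk u [(u, v)] v"
  using arc_implies_awalk[of "(u, v)"] by simp

lemma arc_iff_graph_dist:
  assumes "u \<in> pverts T" "v \<in> pverts T"
  shows "(u, v) \<in> parcs T \<longleftrightarrow> graph_dist T u v = 1"
proof
  assume uv: "(u, v) \<in> parcs T"
  then have "graph_dist T u v \<noteq> 0" using graph_dist_eq_0_iff[OF assms] no_loops' by blast
  then show "graph_dist T u v = 1" using graph_dist_le[OF arc_awalk[OF uv]] by simp
next
  assume 1: "graph_dist T u v = 1"
  obtain p where p: "awalk u p v" "length p = graph_dist T u v" using shortest_walk[OF assms] .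
  then obtain e where "p = [e]" using 1 by (auto simp: length_Suc_conv)
  then show "(u, v) \<in> parcs T" using p(1) by (cases e) (auto simp: awalk_simps)
qed

lemma closer_neighbour:
  assumes "u \<in> pverts T" "k \<in> pverts T" "u \<noteq> k"
  shows "\<exists>p\<in>neighbours T u. graph_dist T u k = Suc (graph_dist T p k)"
proof -
  obtain p where p: "awalk u p k" "length p = graph_dist T u k" using shortest_walk[OF assms(1,2)] .
  then obtain e es where e: "p = e # es" using assms(3) awalk_empty_ends by (cases p) auto
  obtain x where x: "e = (u, x)" "(u, x) \<in> parcs T" "awalk x es k"
    using p(1) e by (cases e) (auto simp: awalk_Cons_iff)
  have "x \<in> pverts T" using x(2) in_arcsD2 by blast
  then have "graph_dist T u k \<le> 1 + graph_dist T x k"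
    using graph_dist_triangle[of u x k] arc_iff_graph_dist[of u x] x(2) assms by simp
  then have "graph_dist T u k = Suc (graph_dist T x k)"
    using graph_dist_le[OF x(3)] p(2) e by simp
  then show ?thesis using x(2) by (auto simp: neighbours_def)
qed

text \<open>
  The use of acyclicity: a walk between two neighbours of \<open>u\<close> that avoids \<open>u\<close> would close up to a
  cycle through \<open>u\<close>, of length at least 3 because the two neighbours are distinct.
\<close>

lemma neighbours_separated:
  assumes x: "(u, x) \<in> parcs T" and y: "(u, y) \<in> parcs T" and "x \<noteq> y" and w: "awalk x w y"
  shows "u \<in> set (awalk_verts x w)"
proof (rule ccontr)
  assume u: "u \<notin> set (awalk_verts x w)"
  define a where "a = awalk_to_apath w"
  have a: "apath x a y" unfolding a_def by (rule apath_awalk_to_apath[OF w])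
  have aw: "awalk x a y" using a by (rule awalkI_apath)
  have ne: "a \<noteq> []" "w \<noteq> []" using aw w assms(3) awalk_empty_ends by auto
  have "set (awalk_verts x a) \<subseteq> set (awalk_verts x w)"
    unfolding set_awalk_verts_not_Nil[OF aw ne(1)] set_awalk_verts_not_Nil[OF w ne(2)]
    using awalk_to_apath_subset[OF w] by (auto simp: a_def)
  then have ua: "u \<notin> set (awalk_verts x a)" using u by blast
  have yu: "awalk y [(y, u)] u" using arc_awalk arcs_symmetric y by blast
  let ?p = "(u, x) # a @ [(y, u)]"
  have "awalk u ?p u" using awalk_appendI[OF aw yu] x by (simp add: awalk_Cons_iff del: awalk_append_iff)
  moreover have "awalk_verts x (a @ [(y, u)]) = awalk_verts x a @ [u]"
    using awalk_verts_append[OF awalk_appendI[OF aw yu]] aw by simp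
  then have "distinct (tl (awalk_verts u ?p))" using a ua by (simp add: apath_def)
  ultimately have "cycle ?p" unfolding cycle_def by blast
  moreover have "3 \<le> length ?p" using ne(1) by (cases a) auto
  ultimately show False using tree unfolding undirected_tree_def by blast
qed

text \<open>
  After visiting \<open>u\<close> the walk would still need at least the distance of \<open>u\<close>, so it would be too long.
\<close>

lemma shortest_walk_avoids:
  assumes "(u, x) \<in> parcs T" and p: "awalk x p k" "length p = graph_dist T x k"
    and "graph_dist T x k \<le> graph_dist T u k"
  shows "u \<notin> set (awalk_verts x p)"
proof
  assume "u \<in> set (awalk_verts x p)"
  then obtain q r where qr: "p = q @ r" "awalk x q u" "awalk u r k" using awalk_decomp[OF p(1)] by blast
  have "q \<noteq> []" using qr(2) awalk_empty_ends no_loops' assms(1) by blast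
  then have "length r < length p" using qr(1) by simp
  then show False using graph_dist_le[OF qr(3)] p(2) assms(4) by simp
qed

text \<open>
  Shortest walks from two such neighbours to \<open>k\<close> avoid \<open>u\<close>; together they connect the neighbours.
\<close>

lemma closer_neighbour_unique:
  assumes k: "k \<in> pverts T" and x: "x \<in> neighbours T u" and y: "y \<in> neighbours T u"
    and "graph_dist T x k \<le> graph_dist T u k" "graph_dist T y k \<le> graph_dist T u k"
  shows "x = y"
proof (rule ccontr)
  assume "x \<noteq> y"
  have arcs: "(u, x) \<in> parcs T" "(u, y) \<in> parcs T" using x y by (simp_all add: neighbours_def)
  have V: "x \<in> pverts T" "y \<in> pverts T" using arcs in_arcsD2 by blast+
  obtain p where p: "awalk x p k" "length p = graph_dist T x k" using shortest_walk[OF V(1) k] .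
  obtain q where q: "awalk y q k" "length q = graph_dist T y k" using shortest_walk[OF V(2) k] .
  have q': "awalk k (rev_path q) y" using q(1) by simp
  have "set (awalk_verts x (p @ rev_path q)) = set (awalk_verts x p) \<union> set (awalk_verts k (rev_path q))"
    by (rule set_awalk_verts_append[OF p(1) q'])
  moreover have "awalk_verts k (rev_path q) = rev (awalk_verts y q)"
    by (rule awalk_verts_rev_path[OF q(1)])
  ultimately have "u \<notin> set (awalk_verts x (p @ rev_path q))"
    using shortest_walk_avoids[OF arcs(1) p] shortest_walk_avoids[OF arcs(2) q] assms by simp
  then show False using neighbours_separated[OF arcs \<open>x \<noteq> y\<close> awalk_appendI[OF p(1) q']] by blast
qed

sublocale tree_metric "pverts T" "neighbours T" "graph_dist T"
proof unfold_locales
  show "finite (pverts T)" by (rule pair_finite_verts)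
  show "neighbours T u \<subseteq> pverts T" for u by (auto simp: neighbours_def dest: in_arcsD2)
  show "graph_dist T u v = 0 \<longleftrightarrow> u = v" if "u \<in> pverts T" "v \<in> pverts T" for u v
    using graph_dist_eq_0_iff that .
  show "graph_dist T u v = graph_dist T v u" if "u \<in> pverts T" "v \<in> pverts T" for u v
    using graph_dist_le_swap that by (intro antisym)
  show "graph_dist T u w \<le> graph_dist T u v + graph_dist T v w"
    if "u \<in> pverts T" "v \<in> pverts T" "w \<in> pverts T" for u v w
    using graph_dist_triangle that .
  show "v \<in> neighbours T u \<longleftrightarrow> graph_dist T u v = 1" if "u \<in> pverts T" "v \<in> pverts T" for u v
    using arc_iff_graph_dist[OF that] by (simp add: neighbours_def)
  show "\<exists>p\<in>neighbours T u. graph_dist T u k = Suc (graph_dist T p k)"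
    if "u \<in> pverts T" "k \<in> pverts T" "u \<noteq> k" for u k
    using closer_neighbour that .
  show "x = y" if "u \<in> pverts T" "k \<in> pverts T" "x \<in> neighbours T u" "y \<in> neighbours T u"
    "graph_dist T x k \<le> graph_dist T u k" "graph_dist T y k \<le> graph_dist T u k" for u k x y
    using closer_neighbour_unique that by blast
qed

lemma diameter_geodesic:
  obtains c where "tree_geodesic (pverts T) (neighbours T) (graph_dist T) c (graph_diameter T)"
proof -
  let ?S = "{graph_dist T u v | u v. u \<in> pverts T \<and> v \<in> pverts T}"
  have "?S = (\<lambda>(u, v). graph_dist T u v) ` (pverts T \<times> pverts T)" by auto
  then have "finite ?S" "?S \<noteq> {}" using finite_V verts_nonempty by simp_all
  then have "graph_diameter T \<in> ?S" unfolding graph_diameter_def by (rule Max_in)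
  then obtain u v where uv: "u \<in> pverts T" "v \<in> pverts T" "graph_diameter T = graph_dist T u v" by auto
  obtain c where "tree_geodesic (pverts T) (neighbours T) (graph_dist T) c (graph_dist T u v)"
    using geodesic_exists[OF uv(1,2)] .
  then show ?thesis using that uv(3) by simp
qed

lemma diameter_pos:
  assumes "card (pverts T) \<noteq> 1"
  shows "0 < graph_diameter T"
proof -
  let ?S = "{graph_dist T u v | u v. u \<in> pverts T \<and> v \<in> pverts T}"
  have "card (pverts T) \<noteq> 0" using verts_nonempty finite_V by simp
  then have "\<not> card (pverts T) \<le> Suc 0" using assms by linarith
  then obtain u v where uv: "u \<in> pverts T" "v \<in> pverts T" "u \<noteq> v"
    using card_le_Suc0_iff_eq[OF finite_V] by auto
  have "?S = (\<lambda>(u, v). graph_dist T u v) ` (pverts T \<times> pverts T)" by auto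
  then have "finite ?S" using finite_V by simp
  then have "graph_dist T u v \<le> graph_diameter T"
    unfolding graph_diameter_def using uv by (intro Max_ge) auto
  moreover have "graph_dist T u v \<noteq> 0" using d_eq_0_iff uv by simp
  ultimately show ?thesis by simp
qed

end

section \<open>Mean first passage times and Kemeny's constant\<close>

text \<open>
  The infimum over a fixed countable index set, which gives measurability and allows shifting the time.
\<close>

lemma hitting_time_INF:
  "hitting_time i j \<omega> = (INF s. if 1 \<le> s \<and> walk i \<omega> s = j then of_nat s else top)"
  unfolding hitting_time_def
proof (rule antisym)
  show "(INF s\<in>{s. 1 \<le> s \<and> walk i \<omega> s = j}. of_nat s)
      \<le> (INF s. if 1 \<le> s \<and> walk i \<omega> s = j then of_nat s else top :: ennreal)"
    by (rule INF_greatest) (auto intro!: INF_lower)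
  show "(INF s. if 1 \<le> s \<and> walk i \<omega> s = j then of_nat s else top)
      \<le> (INF s\<in>{s. 1 \<le> s \<and> walk i \<omega> s = j}. of_nat s :: ennreal)"
  proof (rule INF_greatest)
    fix s assume "s \<in> {s. 1 \<le> s \<and> walk i \<omega> s = j}"
    then show "(INF s. if 1 \<le> s \<and> walk i \<omega> s = j then of_nat s else top) \<le> (of_nat s :: ennreal)"
      by (intro INF_lower2[of s]) auto
  qed
qed

text \<open>
  The Markov property on the level of paths: after the first map of the stream the walk starts afresh
  at \<open>f i\<close>.
\<close>

lemma hitting_time_Stream:
  "hitting_time i j (f ## \<omega>) = (if f i = j then 1 else 1 + hitting_time (f i) j \<omega>)"
proof (cases "f i = j")
  case True
  have "hitting_time i j (f ## \<omega>) \<le> of_nat 1"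
    unfolding hitting_time_def using True walk_Stream[of i f \<omega> 0] by (intro INF_lower) simp
  moreover have "1 \<le> hitting_time i j (f ## \<omega>)"
    unfolding hitting_time_def by (intro INF_greatest) (metis (mono_tags) mem_Collect_eq of_nat_1 of_nat_mono)
  ultimately show ?thesis using True by simp
next
  case False
  let ?g = "\<lambda>s. if 1 \<le> s \<and> walk i (f ## \<omega>) s = j then of_nat s else top :: ennreal"
  have "hitting_time i j (f ## \<omega>) = (INF s. ?g s)" by (rule hitting_time_INF)
  \<comment> \<open>time 0 contributes \<open>top\<close>, so that it can be dropped\<close>
  also have "\<dots> = (INF s. ?g (Suc s))"
  proof (rule antisym)
    show "(INF s. ?g s) \<le> (INF s. ?g (Suc s))" by (rule INF_greatest) (rule INF_lower, simp)
    have "(INF s. ?g (Suc s)) \<le> ?g s" for s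
    proof (cases s)
      case (Suc k)
      then show ?thesis by (simp only:) (rule INF_lower, simp)
    qed simp
    then show "(INF s. ?g (Suc s)) \<le> (INF s. ?g s)" by (intro INF_greatest)
  qed
  also have "\<dots> = (INF s. 1 + (if 1 \<le> s \<and> walk (f i) \<omega> s = j then of_nat s else top))"
  proof (intro INF_cong refl)
    fix s
    show "?g (Suc s) = 1 + (if 1 \<le> s \<and> walk (f i) \<omega> s = j then of_nat s else top)"
      using False walk_Stream[of i f \<omega> s] by (cases s) simp_all
  qed
  also have "\<dots> = 1 + hitting_time (f i) j \<omega>"
    unfolding hitting_time_INF by (rule INF_ennreal_const_add)
  finally show ?thesis using False by simp
qed

locale nontrivial_tree = tree_graph +
  assumes nontrivial: "card (pverts T) \<noteq> 1"
begin

abbreviation (input) n :: real where "n \<equiv> real (card (pverts T))"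
abbreviation (input) deg :: "'a \<Rightarrow> real" where "deg v \<equiv> real (card (neighbours T v))"

lemma card_ge_2: "2 \<le> card (pverts T)"
proof -
  have "card (pverts T) \<noteq> 0" using verts_nonempty finite_V by simp
  then show ?thesis using nontrivial by linarith
qed

lemma no_isolated: "v \<in> pverts T \<Longrightarrow> neighbours T v \<noteq> {}"
proof -
  assume v: "v \<in> pverts T"
  have "\<not> pverts T \<subseteq> {v}" using card_ge_2 card_mono[of "{v}" "pverts T"] by auto
  then obtain k where "k \<in> pverts T" "v \<noteq> k" by blast
  then show ?thesis using parent_exists[OF v] by blast
qed

lemma deg_pos: "v \<in> pverts T \<Longrightarrow> 0 < deg v"
  using no_isolated finite_nb by (simp add: card_gt_0_iff)

lemma transition_eq:
  assumes "v \<in> pverts T"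
  shows "transition T v x = (if x \<in> neighbours T v then 1 / deg v else 0)"
  using card_neighbours[OF pair_graph_T no_isolated, of v]
  by (simp add: transition_def adjacency_def neighbours_def)

lemma sum_adjacent:
  assumes "j \<in> pverts T"
  shows "(\<Sum>i\<in>pverts T. if j \<in> neighbours T i then f i else 0) = (\<Sum>i\<in>neighbours T j. f i :: real)"
proof -
  have "(\<Sum>i\<in>pverts T. if j \<in> neighbours T i then f i else 0) = (\<Sum>i\<in>{i \<in> pverts T. j \<in> neighbours T i}. f i)"
    by (rule sum.inter_filter[symmetric, OF finite_V])
  also have "{i \<in> pverts T. j \<in> neighbours T i} = neighbours T j"
    using nb_sym nb_in_V assms by blast
  finally show ?thesis .
qed

text \<open>
  Dividing a stationary distribution by the degree yields a harmonic function, because adjacency is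
  symmetric. It is therefore constant, and the normalisation determines the constant.
\<close>

lemma stationary_eq:
  assumes "j \<in> pverts T"
  shows "stationary T j = deg j / (2 * (n - 1))"
proof -
  let ?w = "\<lambda>j. if j \<in> pverts T then deg j / (2 * (n - 1)) else 0"
  have n1: "n - 1 > 0" using card_ge_2 by simp
  have flow: "(\<Sum>i\<in>pverts T. w i * transition T i j) = (\<Sum>i\<in>neighbours T j. w i / deg i)"
    if "j \<in> pverts T" for w :: "'a \<Rightarrow> real" and j
  proof -
    have "(\<Sum>i\<in>pverts T. w i * transition T i j) =
        (\<Sum>i\<in>pverts T. if j \<in> neighbours T i then w i / deg i else 0)"
      by (intro sum.cong refl) (simp add: transition_eq)
    then show ?thesis using sum_adjacent[OF that] by simp
  qed
  have "is_stationary T ?w"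
    unfolding is_stationary_def
  proof (intro conjI ballI allI impI)
    fix j assume j: "j \<in> pverts T"
    show "0 < ?w j" using deg_pos[OF j] n1 j by simp
    have "(\<Sum>i\<in>neighbours T j. ?w i / deg i) = (\<Sum>i\<in>neighbours T j. 1 / (2 * (n - 1)))"
    proof (intro sum.cong refl)
      fix i assume "i \<in> neighbours T j"
      then have "i \<in> pverts T" by (rule nb_in_V)
      then show "?w i / deg i = 1 / (2 * (n - 1))" using deg_pos[of i] by simp
    qed
    then show "(\<Sum>i\<in>pverts T. ?w i * transition T i j) = ?w j"
      using flow[OF j, of ?w] j by simp
  next
    have "(\<Sum>j\<in>pverts T. ?w j) = (\<Sum>j\<in>pverts T. deg j) / (2 * (n - 1))"
      by (simp add: sum_divide_distrib)
    then show "(\<Sum>j\<in>pverts T. ?w j) = 1" using sum_degrees[OF assms] n1 by simp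
  qed simp
  moreover have "w = ?w" if st: "is_stationary T w" for w
  proof
    fix v
    show "w v = ?w v"
    proof (cases "v \<in> pverts T")
      case True
      have harm: "deg u * (w u / deg u) = (\<Sum>x\<in>neighbours T u. w x / deg x)" if "u \<in> pverts T" for u
        using st flow[OF that, of w] deg_pos[OF that] that by (simp add: is_stationary_def)
      have const: "w u / deg u = w v / deg v" if "u \<in> pverts T" for u
        using harmonic_imp_constant[OF True that, of "\<lambda>u. w u / deg u"] harm by simp
      have "1 = (\<Sum>u\<in>pverts T. w u)" using st by (simp add: is_stationary_def)
      also have "\<dots> = (\<Sum>u\<in>pverts T. deg u * (w v / deg v))"
      proof (intro sum.cong refl)
        fix u assume "u \<in> pverts T"
        then show "w u = deg u * (w v / deg v)" using const[of u, symmetric] deg_pos[of u] by simp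
      qed
      also have "\<dots> = 2 * (n - 1) * (w v / deg v)"
        by (simp only: sum_distrib_right[symmetric] sum_degrees[OF True])
      finally show ?thesis using deg_pos[OF True] n1 True by (simp add: field_simps)
    next
      case False
      then show ?thesis using st by (simp add: is_stationary_def)
    qed
  qed
  ultimately have "stationary T = ?w" unfolding stationary_def by (rule the_equality)
  then show ?thesis using assms by simp
qed

abbreviation (input) "maps \<equiv> \<Pi>\<^sub>E v\<in>pverts T. neighbours T v"
abbreviation (input) "step \<equiv> uniform_count_measure maps"

lemma nn_integral_step:
  assumes i: "i \<in> pverts T"
  shows "(\<integral>\<^sup>+ f. \<phi> (f i) \<partial>step) = (\<Sum>x\<in>neighbours T i. ennreal (1 / deg i) * \<phi> x)"
proof -
  have "(\<integral>\<^sup>+ f. \<phi> (f i) \<partial>step) = (\<integral>\<^sup>+ f. (\<Sum>x\<in>neighbours T i. \<phi> x * indicator {f \<in> maps. f i = x} f) \<partial>step)"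
  proof (rule nn_integral_cong)
    fix f assume "f \<in> space step"
    then have f: "f \<in> maps" by (simp add: space_uniform_count_measure)
    then have fi: "f i \<in> neighbours T i" using i by (rule PiE_mem)
    have "(\<Sum>x\<in>neighbours T i. \<phi> x * indicator {f \<in> maps. f i = x} f) =
        (\<Sum>x\<in>neighbours T i. if x = f i then \<phi> x else 0)"
      using f by (intro sum.cong) (auto simp: indicator_def)
    then show "\<phi> (f i) = (\<Sum>x\<in>neighbours T i. \<phi> x * indicator {f \<in> maps. f i = x} f)"
      using fi finite_nb by simp
  qed
  also have "\<dots> = (\<Sum>x\<in>neighbours T i. \<integral>\<^sup>+ f. \<phi> x * indicator {f \<in> maps. f i = x} f \<partial>step)"
    by (rule nn_integral_sum) (simp add: measurable_def space_uniform_count_measure sets_uniform_count_measure)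
  also have "\<dots> = (\<Sum>x\<in>neighbours T i. \<phi> x * emeasure step {f \<in> maps. f i = x})"
    by (intro sum.cong refl nn_integral_cmult_indicator) (simp add: sets_uniform_count_measure)
  also have "\<dots> = (\<Sum>x\<in>neighbours T i. ennreal (1 / deg i) * \<phi> x)"
  proof (intro sum.cong refl)
    fix x assume "x \<in> neighbours T i"
    then have "emeasure step {f \<in> maps. f i = x} = ennreal (1 / deg i)"
      using measure_Step[OF pair_graph_T no_isolated i, of x] transition_eq[OF i, of x] by (simp only: if_True)
    then show "\<phi> x * emeasure step {f \<in> maps. f i = x} = ennreal (1 / deg i) * \<phi> x"
      by (simp only: mult.commute)
  qed
  finally show ?thesis .
qed

lemma first_step:
  assumes i: "i \<in> pverts T" and F: "F \<in> borel_measurable (walk_space T)"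
    and shift: "\<And>f \<omega>. F (f ## \<omega>) = F' (f i) \<omega>"
  shows "(\<integral>\<^sup>+ \<omega>. F \<omega> \<partial>walk_space T) =
    (\<Sum>x\<in>neighbours T i. ennreal (1 / deg i) * (\<integral>\<^sup>+ \<omega>. F' x \<omega> \<partial>walk_space T))"
proof -
  interpret S: prob_space step by (rule prob_space_Step[OF pair_graph_T no_isolated])
  have "(\<integral>\<^sup>+ \<omega>. F \<omega> \<partial>walk_space T) = (\<integral>\<^sup>+ f. (\<integral>\<^sup>+ \<omega>. F (f ## \<omega>) \<partial>walk_space T) \<partial>step)"
    unfolding walk_space_def by (rule S.nn_integral_stream_space[OF F[unfolded walk_space_def]])
  also have "\<dots> = (\<integral>\<^sup>+ f. (\<integral>\<^sup>+ \<omega>. F' (f i) \<omega> \<partial>walk_space T) \<partial>step)"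
    by (simp only: shift)
  also have "\<dots> = (\<Sum>x\<in>neighbours T i. ennreal (1 / deg i) * (\<integral>\<^sup>+ \<omega>. F' x \<omega> \<partial>walk_space T))"
    by (rule nn_integral_step[OF i])
  finally show ?thesis .
qed

lemma measurable_hitting_time:
  assumes "i \<in> pverts T"
  shows "hitting_time i j \<in> borel_measurable (walk_space T)"
proof -
  have single: "(\<lambda>\<omega>. if 1 \<le> s \<and> walk i \<omega> s = j then of_nat s else top :: ennreal) \<in> borel_measurable (walk_space T)" for s
  proof (rule measurable_compose[OF measurable_walk[OF pair_graph_T no_isolated assms, of s],
        of "\<lambda>x. if 1 \<le> s \<and> x = j then of_nat s else top :: ennreal"])
    show "(\<lambda>x. if 1 \<le> s \<and> x = j then of_nat s else top :: ennreal) \<in> borel_measurable (count_space (pverts T))"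
      by (rule borel_measurable_count_space)
  qed
  show ?thesis
    unfolding hitting_time_INF[abs_def]
    by (rule borel_measurable_INF, rule countableI_type, rule single)
qed

lemma nn_integral_one_plus:
  assumes "F \<in> borel_measurable (walk_space T)"
  shows "(\<integral>\<^sup>+ \<omega>. 1 + F \<omega> \<partial>walk_space T) = 1 + (\<integral>\<^sup>+ \<omega>. F \<omega> \<partial>walk_space T)"
proof -
  interpret W: prob_space "walk_space T" by (rule prob_space_walk_space[OF pair_graph_T no_isolated])
  show ?thesis using assms by (simp add: nn_integral_add W.emeasure_space_1)
qed

lemma expected_hitting_time_rec:
  assumes i: "i \<in> pverts T"
  shows "(\<integral>\<^sup>+ \<omega>. hitting_time i j \<omega> \<partial>walk_space T) = (\<Sum>x\<in>neighbours T i. ennreal (1 / deg i) *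
    (if x = j then 1 else 1 + (\<integral>\<^sup>+ \<omega>. hitting_time x j \<omega> \<partial>walk_space T)))"
proof -
  interpret W: prob_space "walk_space T" by (rule prob_space_walk_space[OF pair_graph_T no_isolated])
  have "(\<integral>\<^sup>+ \<omega>. hitting_time i j \<omega> \<partial>walk_space T) = (\<Sum>x\<in>neighbours T i. ennreal (1 / deg i) *
      (\<integral>\<^sup>+ \<omega>. (if x = j then 1 else 1 + hitting_time x j \<omega>) \<partial>walk_space T))"
    by (rule first_step[OF i measurable_hitting_time[OF i], of j "\<lambda>x \<omega>. if x = j then 1 else 1 + hitting_time x j \<omega>"])
       (simp add: hitting_time_Stream)
  also have "\<dots> = (\<Sum>x\<in>neighbours T i. ennreal (1 / deg i) *
    (if x = j then 1 else 1 + (\<integral>\<^sup>+ \<omega>. hitting_time x j \<omega> \<partial>walk_space T)))"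
  proof (intro sum.cong refl)
    fix x assume "x \<in> neighbours T i"
    then have "x \<in> pverts T" by (rule nb_in_V)
    note 1 = nn_integral_one_plus[OF measurable_hitting_time[OF this, of j]]
    show "ennreal (1 / deg i) * (\<integral>\<^sup>+ \<omega>. (if x = j then 1 else 1 + hitting_time x j \<omega>) \<partial>walk_space T) =
      ennreal (1 / deg i) * (if x = j then 1 else 1 + (\<integral>\<^sup>+ \<omega>. hitting_time x j \<omega> \<partial>walk_space T))"
      by (cases "x = j") (simp_all add: W.emeasure_space_1 1)
  qed
  finally show ?thesis .
qed

lemma sum_ennreal_hit:
  assumes "i \<in> pverts T" "j \<in> pverts T" "i \<noteq> j"
  shows "(\<Sum>x\<in>neighbours T i. ennreal (1 / deg i) * ennreal (1 + hit x j)) = ennreal (hit i j)"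
proof -
  have nn: "0 \<le> hit x j" if "x \<in> neighbours T i" for x using hit_nonneg assms nb_in_V[OF that] by simp
  have "(\<Sum>x\<in>neighbours T i. ennreal (1 / deg i) * ennreal (1 + hit x j)) =
      (\<Sum>x\<in>neighbours T i. ennreal (1 / deg i * (1 + hit x j)))"
    using nn by (intro sum.cong refl ennreal_mult[symmetric]) (auto intro: add_nonneg_nonneg)
  also have "\<dots> = ennreal (\<Sum>x\<in>neighbours T i. 1 / deg i * (1 + hit x j))"
    using nn by (intro sum_ennreal) (auto intro: add_nonneg_nonneg)
  also have "(\<Sum>x\<in>neighbours T i. 1 / deg i * (1 + hit x j)) = (deg i + (\<Sum>x\<in>neighbours T i. hit x j)) / deg i"
    by (simp only: sum_distrib_left[symmetric] sum.distrib) simp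
  also have "deg i + (\<Sum>x\<in>neighbours T i. hit x j) = deg i * hit i j"
    using sum_nb_hit[OF assms(1,2)] assms(3) by (simp add: right_diff_distrib)
  also have "deg i * hit i j / deg i = hit i j"
    using deg_pos[OF assms(1)] by simp
  finally show ?thesis .
qed

text \<open>
  Truncation at \<open>N\<close> makes an induction possible: the first-step equation bounds the truncation at
  \<open>Suc N\<close> by that at \<open>N\<close>, and \<open>hit\<close> is a fixed point of the same equation.
\<close>

lemma truncated_hitting_time_le:
  assumes j: "j \<in> pverts T"
  shows "\<lbrakk>i \<in> pverts T; i \<noteq> j\<rbrakk> \<Longrightarrow>
    (\<integral>\<^sup>+ \<omega>. min (of_nat N) (hitting_time i j \<omega>) \<partial>walk_space T) \<le> ennreal (hit i j)"
proof (induction N arbitrary: i)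
  case 0
  then show ?case by simp
next
  case (Suc N)
  interpret W: prob_space "walk_space T" by (rule prob_space_walk_space[OF pair_graph_T no_isolated])
  note [measurable] = measurable_hitting_time
  have "(\<integral>\<^sup>+ \<omega>. min (of_nat (Suc N)) (hitting_time i j \<omega>) \<partial>walk_space T) =
     (\<Sum>x\<in>neighbours T i. ennreal (1 / deg i) *
      (\<integral>\<^sup>+ \<omega>. min (of_nat (Suc N)) (if x = j then 1 else 1 + hitting_time x j \<omega>) \<partial>walk_space T))"
    using Suc.prems by (intro first_step) (simp_all add: hitting_time_Stream)
  also have "\<dots> \<le> (\<Sum>x\<in>neighbours T i. ennreal (1 / deg i) * ennreal (1 + hit x j))"
  proof (intro sum_mono mult_left_mono)
    fix x assume "x \<in> neighbours T i"
    then have x: "x \<in> pverts T" by (rule nb_in_V)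
    show "(\<integral>\<^sup>+ \<omega>. min (of_nat (Suc N)) (if x = j then 1 else 1 + hitting_time x j \<omega>) \<partial>walk_space T)
        \<le> ennreal (1 + hit x j)"
    proof (cases "x = j")
      case True
      have "(\<integral>\<^sup>+ \<omega>. min (of_nat (Suc N)) (if x = j then 1 else 1 + hitting_time x j \<omega>) \<partial>walk_space T)
          \<le> (\<integral>\<^sup>+ \<omega>. 1 \<partial>walk_space T)"
        using True by (intro nn_integral_mono) simp
      then show ?thesis using True hit_self[OF j] by (simp add: W.emeasure_space_1)
    next
      case False
      have "(\<integral>\<^sup>+ \<omega>. min (of_nat (Suc N)) (if x = j then 1 else 1 + hitting_time x j \<omega>) \<partial>walk_space T) =
         (\<integral>\<^sup>+ \<omega>. 1 + min (of_nat N) (hitting_time x j \<omega>) \<partial>walk_space T)"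
        using False by (intro nn_integral_cong) (auto simp: min_def)
      also have "\<dots> = 1 + (\<integral>\<^sup>+ \<omega>. min (of_nat N) (hitting_time x j \<omega>) \<partial>walk_space T)"
        using x by (intro nn_integral_one_plus) measurable
      also have "\<dots> \<le> 1 + ennreal (hit x j)"
        using Suc.IH[OF x False] by (rule add_left_mono)
      finally show ?thesis using hit_nonneg[OF x j] by (simp add: ennreal_plus)
    qed
  qed simp
  also have "\<dots> = ennreal (hit i j)"
    using sum_ennreal_hit Suc.prems j by blast
  finally show ?case .
qed

lemma expected_hitting_time_le:
  assumes i: "i \<in> pverts T" and j: "j \<in> pverts T" and "i \<noteq> j"
  shows "(\<integral>\<^sup>+ \<omega>. hitting_time i j \<omega> \<partial>walk_space T) \<le> ennreal (hit i j)"
proof -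
  note [measurable] = measurable_hitting_time[OF i]
  have "(SUP N. min (of_nat N) y) = y" for y :: ennreal
  proof -
    have "(SUP N. min (of_nat N) y) = min (SUP N. of_nat N) y"
      using SUP_inf[of "of_nat :: nat \<Rightarrow> ennreal" UNIV y] by (simp add: inf_min)
    then show ?thesis by (simp add: ennreal_SUP_of_nat_eq_top)
  qed
  then have "(\<integral>\<^sup>+ \<omega>. hitting_time i j \<omega> \<partial>walk_space T) =
      (\<integral>\<^sup>+ \<omega>. (SUP N. min (of_nat N) (hitting_time i j \<omega>)) \<partial>walk_space T)" by simp
  also have "\<dots> = (SUP N. \<integral>\<^sup>+ \<omega>. min (of_nat N) (hitting_time i j \<omega>) \<partial>walk_space T)"
  proof (rule nn_integral_monotone_convergence_SUP)
    show "incseq (\<lambda>N \<omega>. min (of_nat N) (hitting_time i j \<omega>))"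
      unfolding incseq_def le_fun_def by (intro allI impI min.mono of_nat_mono order_refl)
  qed measurable
  also have "\<dots> \<le> ennreal (hit i j)"
    using truncated_hitting_time_le assms by (intro SUP_least) blast
  finally show ?thesis .
qed

text \<open>
  Since the expectation is finite, \<open>enn2real\<close> in the definition of \<open>mean_first_passage\<close> loses nothing, and
  the recursion can be transferred to the real numbers.
\<close>

lemma expected_hitting_time_finite:
  assumes i: "i \<in> pverts T" and j: "j \<in> pverts T"
  shows "(\<integral>\<^sup>+ \<omega>. hitting_time i j \<omega> \<partial>walk_space T) = ennreal (mean_first_passage T i j)"
proof -
  have off: "(\<integral>\<^sup>+ \<omega>. hitting_time x j \<omega> \<partial>walk_space T) < top" if "x \<in> pverts T" "x \<noteq> j" for x
    using expected_hitting_time_le[OF that(1) j that(2)] ennreal_less_top le_less_trans by blast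
  have "(\<integral>\<^sup>+ \<omega>. hitting_time i j \<omega> \<partial>walk_space T) < top"
    unfolding expected_hitting_time_rec[OF i, of j]
  proof (subst ennreal_sum_less_top)
    show "finite (neighbours T i)" by (rule finite_nb)
    have "ennreal (1 / deg i) * (if x = j then 1 else 1 + (\<integral>\<^sup>+ \<omega>. hitting_time x j \<omega> \<partial>walk_space T)) < top"
      if "x \<in> neighbours T i" for x
      using off[OF nb_in_V[OF that]] by (simp add: ennreal_mult_less_top)
    then show "\<forall>x\<in>neighbours T i. ennreal (1 / deg i) *
        (if x = j then 1 else 1 + (\<integral>\<^sup>+ \<omega>. hitting_time x j \<omega> \<partial>walk_space T)) < top" by blast
  qed
  then show ?thesis by (simp add: mean_first_passage_def)
qed

lemma mean_first_passage_rec: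
  assumes i: "i \<in> pverts T" and j: "j \<in> pverts T"
  shows "deg i * mean_first_passage T i j =
    deg i + (\<Sum>x\<in>neighbours T i. if x = j then 0 else mean_first_passage T x j)"
proof -
  have nn: "0 \<le> mean_first_passage T x j" for x by (simp add: mean_first_passage_def)
  have "ennreal (mean_first_passage T i j) = (\<Sum>x\<in>neighbours T i. ennreal (1 / deg i) *
    (if x = j then 1 else 1 + ennreal (mean_first_passage T x j)))"
    unfolding expected_hitting_time_finite[OF i j, symmetric] expected_hitting_time_rec[OF i, of j]
    by (intro sum.cong refl) (simp add: expected_hitting_time_finite[OF nb_in_V[of _ i] j])
  also have "\<dots> = (\<Sum>x\<in>neighbours T i. ennreal (1 / deg i * (1 + (if x = j then 0 else mean_first_passage T x j))))"
  proof (intro sum.cong refl)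
    fix x
    have "ennreal (1 / deg i * (1 + (if x = j then 0 else mean_first_passage T x j))) =
        ennreal (1 / deg i) * ennreal (1 + (if x = j then 0 else mean_first_passage T x j))"
      using nn[of x] by (intro ennreal_mult) auto
    also have "ennreal (1 + (if x = j then 0 else mean_first_passage T x j)) =
        (if x = j then 1 else 1 + ennreal (mean_first_passage T x j))"
      using nn[of x] by (simp add: ennreal_plus)
    finally show "ennreal (1 / deg i) * (if x = j then 1 else 1 + ennreal (mean_first_passage T x j)) =
        ennreal (1 / deg i * (1 + (if x = j then 0 else mean_first_passage T x j)))" by (rule sym)
  qed
  also have "\<dots> = ennreal (\<Sum>x\<in>neighbours T i. 1 / deg i * (1 + (if x = j then 0 else mean_first_passage T x j)))"
    using nn by (intro sum_ennreal) simp
  finally have "mean_first_passage T i j =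
      (\<Sum>x\<in>neighbours T i. 1 / deg i * (1 + (if x = j then 0 else mean_first_passage T x j)))"
    using nn by (subst (asm) ennreal_inj) (auto intro!: sum_nonneg)
  also have "\<dots> = 1 / deg i * (deg i + (\<Sum>x\<in>neighbours T i. if x = j then 0 else mean_first_passage T x j))"
    by (simp only: sum_distrib_left[symmetric] sum.distrib) simp
  finally show ?thesis using deg_pos[OF i] by simp
qed

text \<open>
  Both sides satisfy the first-step equations, so their difference, set to zero at \<open>j\<close>, is harmonic off
  \<open>j\<close>.
\<close>

lemma mean_first_passage_eq_hit:
  assumes i: "i \<in> pverts T" and j: "j \<in> pverts T" and "i \<noteq> j"
  shows "mean_first_passage T i j = hit i j"
proof -
  let ?e = "\<lambda>x. (if x = j then 0 else mean_first_passage T x j) - hit x j"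
  have "?e i = ?e j"
  proof (rule harmonic_imp_constant[OF j i])
    fix u assume u: "u \<in> pverts T" "u \<noteq> j"
    show "deg u * ?e u = (\<Sum>x\<in>neighbours T u. ?e x)"
      using mean_first_passage_rec[OF u(1) j] sum_nb_hit[OF u(1) j] u(2)
      by (simp add: sum_subtractf right_diff_distrib)
  qed
  then show ?thesis using assms(3) hit_self[OF j] by simp
qed

lemma mean_return_time:
  assumes j: "j \<in> pverts T"
  shows "deg j * mean_first_passage T j j = 2 * (n - 1)"
proof -
  have "(\<Sum>x\<in>neighbours T j. if x = j then 0 else mean_first_passage T x j) = (\<Sum>x\<in>neighbours T j. hit x j)"
    using mean_first_passage_eq_hit[OF nb_in_V j] hit_self[OF j] by (intro sum.cong refl) auto
  then show ?thesis
    using mean_first_passage_rec[OF j j] sum_nb_hit[OF j j] hit_self[OF j] by simp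
qed

theorem kemeny_eq:
  "kemeny T = (\<Sum>u\<in>pverts T. \<Sum>v\<in>pverts T. real (graph_dist T u v)) / (n - 1) - (2 * n - 1) / 2"
    (is "_ = ?K")
proof -
  have n1: "n - 1 > 0" using card_ge_2 by simp
  have "(\<Sum>j\<in>pverts T. mean_first_passage T i j * stationary T j) - 1 = ?K" if i: "i \<in> pverts T" for i
  proof -
    have "(\<Sum>j\<in>pverts T. mean_first_passage T i j * stationary T j) =
        (\<Sum>j\<in>pverts T. hit i j * deg j / (2 * (n - 1)) + (if j = i then 1 else 0))"
    proof (intro sum.cong refl)
      fix j assume j: "j \<in> pverts T"
      show "mean_first_passage T i j * stationary T j =
          hit i j * deg j / (2 * (n - 1)) + (if j = i then 1 else 0)"
        using mean_return_time[OF i] mean_first_passage_eq_hit[OF i j] hit_self[OF i] n1 stationary_eq[OF j]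
        by (cases "j = i") (simp_all add: mult.commute)
    qed
    also have "\<dots> = (\<Sum>j\<in>pverts T. hit i j * deg j) / (2 * (n - 1)) + 1"
      using i finite_V by (simp add: sum.distrib sum_divide_distrib)
    also have "(\<Sum>j\<in>pverts T. hit i j * deg j) =
        (4 * (\<Sum>u\<in>pverts T. \<Sum>v\<in>pverts T. real (graph_dist T u v)) - 2 * (n - 1) * (2 * n - 1)) / 2"
      using sum_hit_degree[OF i] sum_degree_degree_dist[OF verts_nonempty] by simp
    finally have sum: "(\<Sum>j\<in>pverts T. mean_first_passage T i j * stationary T j) =
        (4 * (\<Sum>u\<in>pverts T. \<Sum>v\<in>pverts T. real (graph_dist T u v)) - 2 * (n - 1) * (2 * n - 1)) / 2
          / (2 * (n - 1)) + 1" .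
    have arith: "(4 * S - 2 * m * q) / 2 / (2 * m) = S / m - q / 2" if "m > 0" for S m q :: real
      using that by (simp add: field_simps)
    show ?thesis by (simp only: sum arith[OF n1] add_diff_cancel_right')
  qed
  then show ?thesis
    unfolding kemeny_def using verts_nonempty by (intro the_equality) auto
qed

end

section \<open>Isomorphism with the caterpillar\<close>

text \<open>
  For graphs whose arcs are pairs of vertices, the map on arcs is determined by the map on vertices. The
  vertex map is taken from \<open>H\<close> to \<open>G\<close>, because below \<open>H\<close> is the caterpillar, whose vertices have names
  from which a map can be defined.
\<close>

lemma digraph_iso_pair_iff:
  assumes "pair_wf_digraph G" "pair_wf_digraph H"
  shows "digraph_iso (with_proj G) (with_proj H) \<longleftrightarrow>
    (\<exists>\<psi>. bij_betw \<psi> (pverts H) (pverts G) \<and>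
      (\<forall>x\<in>pverts H. \<forall>y\<in>pverts H. (x, y) \<in> parcs H \<longleftrightarrow> (\<psi> x, \<psi> y) \<in> parcs G))"
proof
  interpret G: pair_wf_digraph G by fact
  assume "digraph_iso (with_proj G) (with_proj H)"
  then obtain f where f: "pre_digraph.digraph_isomorphism (with_proj G) f" "with_proj H = app_iso f (with_proj G)"
    unfolding digraph_iso_def by blast
  define \<phi> where "\<phi> = iso_verts f"
  have H: "pverts H = \<phi> ` pverts G" "parcs H = iso_arcs f ` parcs G" "iso_tail f = fst" "iso_head f = snd"
    using arg_cong[OF f(2), of verts] arg_cong[OF f(2), of arcs] arg_cong[OF f(2), of tail]
      arg_cong[OF f(2), of head] by (simp_all add: \<phi>_def)
  have inj: "inj_on \<phi> (pverts G)"
    using f(1) by (simp add: pre_digraph.digraph_isomorphism_def \<phi>_def)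
  then have bij: "bij_betw \<phi> (pverts G) (pverts H)" by (simp add: bij_betw_def H)
  have arc: "iso_arcs f (u, v) = (\<phi> u, \<phi> v)" if "(u, v) \<in> parcs G" for u v
    using f(1) that by (auto simp: pre_digraph.digraph_isomorphism_def \<phi>_def H(3,4) intro!: prod_eqI)
  have iff: "(\<phi> u, \<phi> v) \<in> parcs H \<longleftrightarrow> (u, v) \<in> parcs G" if "u \<in> pverts G" "v \<in> pverts G" for u v
  proof
    assume "(\<phi> u, \<phi> v) \<in> parcs H"
    then obtain a b where ab: "(a, b) \<in> parcs G" "(\<phi> u, \<phi> v) = (\<phi> a, \<phi> b)"
      using arc unfolding H(2) by auto
    then have "u = a" "v = b" using inj that G.in_arcsD1 G.in_arcsD2 by (auto dest: inj_onD)
    then show "(u, v) \<in> parcs G" using ab by simp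
  next
    assume "(u, v) \<in> parcs G"
    then show "(\<phi> u, \<phi> v) \<in> parcs H" unfolding H(2) using arc by (metis imageI)
  qed
  let ?\<psi> = "the_inv_into (pverts G) \<phi>"
  have "bij_betw ?\<psi> (pverts H) (pverts G)" by (rule bij_betw_the_inv_into[OF bij])
  moreover have "(x, y) \<in> parcs H \<longleftrightarrow> (?\<psi> x, ?\<psi> y) \<in> parcs G" if "x \<in> pverts H" "y \<in> pverts H" for x y
    using iff[of "?\<psi> x" "?\<psi> y"] that calculation f_the_inv_into_f_bij_betw[OF bij]
    by (auto dest: bij_betwE)
  ultimately show "\<exists>\<psi>. bij_betw \<psi> (pverts H) (pverts G) \<and>
      (\<forall>x\<in>pverts H. \<forall>y\<in>pverts H. (x, y) \<in> parcs H \<longleftrightarrow> (\<psi> x, \<psi> y) \<in> parcs G)" by blast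
next
  interpret G: pair_wf_digraph G by fact
  interpret H: pair_wf_digraph H by fact
  assume "\<exists>\<psi>. bij_betw \<psi> (pverts H) (pverts G) \<and>
      (\<forall>x\<in>pverts H. \<forall>y\<in>pverts H. (x, y) \<in> parcs H \<longleftrightarrow> (\<psi> x, \<psi> y) \<in> parcs G)"
  then obtain \<psi> where bij: "bij_betw \<psi> (pverts H) (pverts G)"
    and arcs: "\<And>x y. \<lbrakk>x \<in> pverts H; y \<in> pverts H\<rbrakk> \<Longrightarrow> (x, y) \<in> parcs H \<longleftrightarrow> (\<psi> x, \<psi> y) \<in> parcs G"
    by blast
  define \<phi> where "\<phi> = the_inv_into (pverts H) \<psi>"
  have bij': "bij_betw \<phi> (pverts G) (pverts H)" unfolding \<phi>_def by (rule bij_betw_the_inv_into[OF bij])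
  have inv: "\<psi> (\<phi> u) = u" if "u \<in> pverts G" for u
    unfolding \<phi>_def using f_the_inv_into_f_bij_betw[OF bij] that by simp
  have inv': "\<phi> (\<psi> x) = x" if "x \<in> pverts H" for x
    unfolding \<phi>_def using bij that by (simp add: bij_betw_def the_inv_into_f_f)
  have mem: "\<phi> u \<in> pverts H" if "u \<in> pverts G" for u using bij' that by (auto dest: bij_betwE)
  have mem': "\<psi> x \<in> pverts G" if "x \<in> pverts H" for x using bij that by (auto dest: bij_betwE)
  have parcs: "parcs H = map_prod \<phi> \<phi> ` parcs G"
  proof (intro set_eqI iffI)
    fix e assume e: "e \<in> parcs H"
    obtain x y where xy: "e = (x, y)" by (cases e)
    have "x \<in> pverts H" "y \<in> pverts H" using e xy H.in_arcsD1 H.in_arcsD2 by blast+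
    then have "(\<psi> x, \<psi> y) \<in> parcs G" "e = map_prod \<phi> \<phi> (\<psi> x, \<psi> y)"
      using e xy arcs inv' by simp_all
    then show "e \<in> map_prod \<phi> \<phi> ` parcs G" by blast
  next
    fix e assume "e \<in> map_prod \<phi> \<phi> ` parcs G"
    then obtain u v where uv: "(u, v) \<in> parcs G" "e = (\<phi> u, \<phi> v)" by auto
    then have "u \<in> pverts G" "v \<in> pverts G" using G.in_arcsD1 G.in_arcsD2 by blast+
    then show "e \<in> parcs H" using uv arcs[of "\<phi> u" "\<phi> v"] mem inv by simp
  qed
  let ?f = "\<lparr>iso_verts = \<phi>, iso_arcs = map_prod \<phi> \<phi>, iso_head = snd, iso_tail = fst\<rparr>"
  have inj: "inj_on \<phi> (pverts G)" using bij' by (simp add: bij_betw_def)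
  have "inj_on (map_prod \<phi> \<phi>) (parcs G)"
  proof (rule inj_on_subset)
    show "inj_on (map_prod \<phi> \<phi>) (pverts G \<times> pverts G)" using inj inj by (rule map_prod_inj_on)
    show "parcs G \<subseteq> pverts G \<times> pverts G" using G.in_arcsD1 G.in_arcsD2 by auto
  qed
  then have "pre_digraph.digraph_isomorphism (with_proj G) ?f"
    using inj G.wf_digraph by (simp add: pre_digraph.digraph_isomorphism_def)
  moreover have "with_proj H = app_iso ?f (with_proj G)"
    using parcs bij' by (simp add: app_iso_def with_proj_def bij_betw_def)
  ultimately show "digraph_iso (with_proj G) (with_proj H)" unfolding digraph_iso_def by blast
qed

lemma pverts_caterpillar:
  "(i, j) \<in> pverts (caterpillar k p) \<longleftrightarrow> 1 \<le> i \<and> i \<le> k \<and> j \<le> p i"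
  by (simp add: caterpillar_def Let_def)

lemma parcs_caterpillar:
  "((i, j), (i', j')) \<in> parcs (caterpillar k p) \<longleftrightarrow>
     j = 0 \<and> j' = 0 \<and> (i' = Suc i \<and> 1 \<le> i \<and> i < k \<or> i = Suc i' \<and> 1 \<le> i' \<and> i' < k) \<or>
     i = i' \<and> 1 \<le> i \<and> i \<le> k \<and> (j = 0 \<and> 1 \<le> j' \<and> j' \<le> p i \<or> j' = 0 \<and> 1 \<le> j \<and> j \<le> p i)"
  by (auto simp: caterpillar_def Let_def)

lemma pair_wf_caterpillar: "pair_wf_digraph (caterpillar k p)"
proof
  fix e assume e: "e \<in> parcs (caterpillar k p)"
  obtain i j i' j' where "e = ((i, j), (i', j'))" by (metis surj_pair)
  then show "fst e \<in> pverts (caterpillar k p)" "snd e \<in> pverts (caterpillar k p)"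
    using e by (auto simp: parcs_caterpillar pverts_caterpillar)
qed

context nontrivial_tree
begin

text \<open>
  In a tree the image of the spine never turns back, so it is a geodesic. The index shift between \<open>c\<close> and
  the spine comes from numbering the spine from 1: its vertex \<open>Suc (\<delta> div 2)\<close>, which carries the leaves,
  corresponds to \<open>c (\<delta> div 2)\<close>.
\<close>

theorem iso_caterpillar_iff:
  fixes \<delta> r :: nat
  defines "C \<equiv> caterpillar (\<delta> + 1) (\<lambda>i. r * unit_vec (Suc (\<delta> div 2)) i)"
  assumes r: "card (pverts T) = r + Suc \<delta>"
  shows "digraph_iso (with_proj T) (with_proj C) \<longleftrightarrow>
    (\<exists>c. tree_geodesic (pverts T) (neighbours T) (graph_dist T) c \<delta> \<and>
      pverts T - c ` {..\<delta>} \<subseteq> neighbours T (c (\<delta> div 2)))"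
    (is "_ \<longleftrightarrow> (\<exists>c. ?geo c \<and> ?hub c)")
proof -
  have wf: "pair_wf_digraph T" "pair_wf_digraph C"
    using pair_graph_T pair_wf_caterpillar
    by (simp_all add: C_def pair_graph_def pair_digraph_def pair_fin_digraph_def)
  let ?t = "Suc (\<delta> div 2)"
  have CV: "(i, j) \<in> pverts C \<longleftrightarrow> 1 \<le> i \<and> i \<le> Suc \<delta> \<and> (j = 0 \<or> i = ?t \<and> j \<le> r)" for i j
    by (auto simp: C_def pverts_caterpillar unit_vec_def)
  have CA: "((i, j), (i', j')) \<in> parcs C \<longleftrightarrow>
     j = 0 \<and> j' = 0 \<and> (i' = Suc i \<and> 1 \<le> i \<and> i \<le> \<delta> \<or> i = Suc i' \<and> 1 \<le> i' \<and> i' \<le> \<delta>) \<or>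
     i = ?t \<and> i' = ?t \<and> (j = 0 \<and> 1 \<le> j' \<and> j' \<le> r \<or> j' = 0 \<and> 1 \<le> j \<and> j \<le> r)" for i j i' j'
    by (auto simp: C_def parcs_caterpillar unit_vec_def split: if_splits)
  show ?thesis
    unfolding digraph_iso_pair_iff[OF wf]
  proof (intro iffI; elim exE conjE)
    fix \<psi> assume bij: "bij_betw \<psi> (pverts C) (pverts T)"
      and "\<forall>x\<in>pverts C. \<forall>y\<in>pverts C. (x, y) \<in> parcs C \<longleftrightarrow> (\<psi> x, \<psi> y) \<in> parcs T"
    then have arcs: "\<psi> y \<in> neighbours T (\<psi> x) \<longleftrightarrow> (x, y) \<in> parcs C" if "x \<in> pverts C" "y \<in> pverts C" for x y
      using that by (simp add: neighbours_def)
    define c where "c i = \<psi> (Suc i, 0)" for i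
    have inj: "inj_on \<psi> (pverts C)" and img: "\<psi> ` pverts C = pverts T"
      using bij by (simp_all add: bij_betw_def)
    have spine: "(Suc i, 0) \<in> pverts C" if "i \<le> \<delta>" for i using that by (simp add: CV)
    have "?geo c"
    proof (rule nonbacktracking_geodesic)
      show "c i \<in> pverts T" if "i \<le> \<delta>" for i using spine[OF that] img unfolding c_def by blast
      show "c (Suc i) \<in> neighbours T (c i)" if "i < \<delta>" for i
        unfolding c_def using that arcs[OF spine spine] by (simp add: CA)
      show "c i \<noteq> c (Suc (Suc i))" if "Suc (Suc i) \<le> \<delta>" for i
        unfolding c_def using that inj_on_eq_iff[OF inj spine spine, of i "Suc (Suc i)"] by simp
    qed
    moreover have "?hub c"
    proof
      fix u assume u: "u \<in> pverts T - c ` {..\<delta>}"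
      then obtain x where x: "x \<in> pverts C" "u = \<psi> x" using img by blast
      obtain i j where ij: "x = (i, j)" by (cases x)
      have "j \<noteq> 0"
      proof
        assume "j = 0"
        then have "u = c (i - 1)" "i - 1 \<le> \<delta>" using x ij by (auto simp: CV c_def)
        then show False using u by blast
      qed
      then have "i = ?t" "1 \<le> j" "j \<le> r" using x(1) ij by (simp_all add: CV)
      then show "u \<in> neighbours T (c (\<delta> div 2))"
        unfolding c_def x(2) using arcs[OF spine x(1), of "\<delta> div 2"] ij by (simp add: CA)
    qed
    ultimately show "\<exists>c. ?geo c \<and> ?hub c" by blast
  next
    fix c assume geo: "?geo c" and "?hub c"
    interpret G: tree_geodesic "pverts T" "neighbours T" "graph_dist T" c \<delta> by (rule geo)
    have hub: "G.off \<subseteq> neighbours T (c (\<delta> div 2))" using \<open>?hub c\<close> by (simp add: G.off_def)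
    have "card G.off = r" using G.card_off r by simp
    then obtain e where e: "bij_betw e {1..r} G.off"
      using ex_bij_betw_nat_finite_1[OF G.finite_off] by blast
    \<comment> \<open>the leaves are numbered from 1, and the number 0 marks the spine\<close>
    define \<psi> where "\<psi> x = (if snd x = 0 then c (fst x - 1) else e (snd x))" for x :: "nat \<times> nat"
    have e_off: "e j \<in> G.off" if "1 \<le> j" "j \<le> r" for j using e that by (auto dest: bij_betwE)
    have e_inj: "e j = e j' \<longleftrightarrow> j = j'" if "1 \<le> j" "j \<le> r" "1 \<le> j'" "j' \<le> r" for j j'
      using e that by (auto simp: bij_betw_def inj_on_eq_iff)
    have c_inj: "c i = c j \<longleftrightarrow> i = j" if "i \<le> \<delta>" "j \<le> \<delta>" for i j
      using G.inj_c that by (auto simp: inj_on_eq_iff)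
    have ec: "e j \<noteq> c i" "c i \<noteq> e j" if "1 \<le> j" "j \<le> r" "i \<le> \<delta>" for i j
    proof -
      have "e j \<notin> c ` {..\<delta>}" "c i \<in> c ` {..\<delta>}" using e_off[OF that(1,2)] that(3) by (simp_all add: G.off_def)
      then show "e j \<noteq> c i" "c i \<noteq> e j" by metis+
    qed
    have "bij_betw \<psi> (pverts C) (pverts T)"
      unfolding bij_betw_def
    proof
      show "inj_on \<psi> (pverts C)"
      proof (rule inj_onI)
        fix x y assume xy: "x \<in> pverts C" "y \<in> pverts C" and eq: "\<psi> x = \<psi> y"
        obtain i j i' j' where s: "x = (i, j)" "y = (i', j')" by (metis surj_pair)
        have V: "1 \<le> i" "i \<le> Suc \<delta>" "j = 0 \<or> i = ?t \<and> j \<le> r" "1 \<le> i'" "i' \<le> Suc \<delta>" "j' = 0 \<or> i' = ?t \<and> j' \<le> r"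
          using xy by (simp_all add: s CV)
        have le: "i - 1 \<le> \<delta>" "i' - 1 \<le> \<delta>" using V by linarith+
        show "x = y"
        proof (cases "j = 0"; cases "j' = 0")
          assume "j = 0" "j' = 0"
          then show ?thesis using V eq c_inj[of "i - 1" "i' - 1"] by (simp add: s \<psi>_def) linarith
        next
          assume "j = 0" "j' \<noteq> 0"
          then show ?thesis using V le eq ec(2)[of j' "i - 1"] by (simp add: s \<psi>_def)
        next
          assume "j \<noteq> 0" "j' = 0"
          then show ?thesis using V le eq ec(1)[of j "i' - 1"] by (simp add: s \<psi>_def)
        next
          assume "j \<noteq> 0" "j' \<noteq> 0"
          then show ?thesis using V eq e_inj[of j j'] by (simp add: s \<psi>_def)
        qed
      qed
      show "\<psi> ` pverts C = pverts T"
      proof (intro set_eqI iffI)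
        fix u assume "u \<in> \<psi> ` pverts C"
        then obtain i j where ij: "(i, j) \<in> pverts C" "u = \<psi> (i, j)" by auto
        then show "u \<in> pverts T"
          using e_off[of j] G.off_in_V[of "e j"] G.c_in_V[of "i - 1"]
          by (cases "j = 0") (auto simp: CV \<psi>_def)
      next
        fix u assume u: "u \<in> pverts T"
        show "u \<in> \<psi> ` pverts C"
        proof (cases "u \<in> c ` {..\<delta>}")
          case True
          then obtain i where "i \<le> \<delta>" "u = c i" by auto
          then have "(Suc i, 0) \<in> pverts C" "u = \<psi> (Suc i, 0)" by (simp_all add: CV \<psi>_def)
          then show ?thesis by blast
        next
          case False
          then have "u \<in> e ` {1..r}" using e u by (simp add: bij_betw_def G.off_def)
          then obtain j where "1 \<le> j" "j \<le> r" "u = e j" by auto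
          then have "(?t, j) \<in> pverts C" "u = \<psi> (?t, j)" by (simp_all add: CV \<psi>_def)
          then show ?thesis by blast
        qed
      qed
    qed
    moreover have "(x, y) \<in> parcs C \<longleftrightarrow> (\<psi> x, \<psi> y) \<in> parcs T" if xy: "x \<in> pverts C" "y \<in> pverts C" for x y
    proof -
      obtain i j i' j' where s: "x = (i, j)" "y = (i', j')" by (metis surj_pair)
      have V: "1 \<le> i" "i \<le> Suc \<delta>" "j = 0 \<or> i = ?t \<and> j \<le> r" "1 \<le> i'" "i' \<le> Suc \<delta>" "j' = 0 \<or> i' = ?t \<and> j' \<le> r"
        using xy by (simp_all add: s CV)
      have sym: "u \<in> neighbours T v \<longleftrightarrow> v \<in> neighbours T u" if "u \<in> pverts T" "v \<in> pverts T" for u v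
        using nb_sym that by blast
      have "\<psi> y \<in> neighbours T (\<psi> x) \<longleftrightarrow> (x, y) \<in> parcs C"
      proof (cases "j = 0"; cases "j' = 0")
        assume j: "j = 0" "j' = 0"
        then have "\<psi> y \<in> neighbours T (\<psi> x) \<longleftrightarrow> i' - 1 = Suc (i - 1) \<or> i - 1 = Suc (i' - 1)"
          using V G.path_adjacent_iff[of "i - 1" "i' - 1"] by (simp add: s \<psi>_def)
        also have "\<dots> \<longleftrightarrow> (x, y) \<in> parcs C"
          unfolding s CA using V j by auto
        finally show ?thesis .
      next
        assume j: "j = 0" "j' \<noteq> 0"
        then have "\<psi> y \<in> neighbours T (\<psi> x) \<longleftrightarrow> i - 1 = \<delta> div 2"
          using V G.hub_adjacent_iff[OF hub e_off[of j'], of "i - 1"] by (simp add: s \<psi>_def)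
        also have "\<dots> \<longleftrightarrow> (x, y) \<in> parcs C"
          unfolding s CA using V j by auto
        finally show ?thesis .
      next
        assume j: "j \<noteq> 0" "j' = 0"
        have "\<psi> y \<in> neighbours T (\<psi> x) \<longleftrightarrow> \<psi> x \<in> neighbours T (\<psi> y)"
          using V j e_off[of j] G.off_in_V[of "e j"] G.c_in_V[of "i' - 1"] by (intro sym) (auto simp: s \<psi>_def)
        also have "\<dots> \<longleftrightarrow> i' - 1 = \<delta> div 2"
          using V j G.hub_adjacent_iff[OF hub e_off[of j], of "i' - 1"] by (simp add: s \<psi>_def)
        also have "\<dots> \<longleftrightarrow> (x, y) \<in> parcs C"
          unfolding s CA using V j by auto
        finally show ?thesis .
      next
        assume j: "j \<noteq> 0" "j' \<noteq> 0"
        then have "\<psi> y \<notin> neighbours T (\<psi> x)"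
          using V G.off_not_adjacent[OF hub e_off[of j] e_off[of j']] by (simp add: s \<psi>_def)
        moreover have "(x, y) \<notin> parcs C"
          unfolding s CA using j by auto
        ultimately show ?thesis by simp
      qed
      then show ?thesis by (simp add: neighbours_def)
    qed
    ultimately show "\<exists>\<psi>. bij_betw \<psi> (pverts C) (pverts T) \<and>
      (\<forall>x\<in>pverts C. \<forall>y\<in>pverts C. (x, y) \<in> parcs C \<longleftrightarrow> (\<psi> x, \<psi> y) \<in> parcs T)" by blast
  qed
qed

text \<open>
  Both central vertices lead to the same caterpillar: if the remaining vertices are neighbours of
  \<open>c (\<delta> - \<delta> div 2)\<close>, the reversed path has them at the vertex with index \<open>\<delta> div 2\<close>.
\<close>

theorem kemeny_lower_bound:
  fixes \<delta> r :: nat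
  defines "\<delta> \<equiv> graph_diameter T" and "r \<equiv> card (pverts T) - graph_diameter T - 1"
  defines "C \<equiv> caterpillar (\<delta> + 1) (\<lambda>i. r * unit_vec (Suc (\<delta> div 2)) i)"
  defines "b \<equiv> real_of_int (min_dist_sum \<delta> r) / (n - 1) - (2 * n - 1) / 2"
  shows "card (pverts T) = r + Suc \<delta>" and "0 < \<delta>"
    and "b \<le> kemeny T" and "kemeny T = b \<longleftrightarrow> digraph_iso (with_proj T) (with_proj C)"
proof -
  obtain c where geo: "tree_geodesic (pverts T) (neighbours T) (graph_dist T) c \<delta>"
    using diameter_geodesic unfolding \<delta>_def .
  interpret G: tree_geodesic "pverts T" "neighbours T" "graph_dist T" c \<delta> by (rule geo)
  show pos: "0 < \<delta>" unfolding \<delta>_def by (rule diameter_pos[OF nontrivial])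
  show card: "card (pverts T) = r + Suc \<delta>"
    using G.card_off by (simp add: r_def \<delta>_def)
  let ?S = "\<Sum>u\<in>pverts T. \<Sum>v\<in>pverts T. int (graph_dist T u v)"
  have n1: "0 < n - 1" using card_ge_2 by simp
  have kemeny: "kemeny T = real_of_int ?S / (n - 1) - (2 * n - 1) / 2"
    using kemeny_eq by simp
  have offr: "card G.off = r" using G.card_off card by simp
  have ge: "min_dist_sum \<delta> r \<le> ?S" using G.dist_sum_ge[OF pos] by (simp add: offr)
  then have "real_of_int (min_dist_sum \<delta> r) / (n - 1) \<le> real_of_int ?S / (n - 1)"
    using n1 by (intro divide_right_mono) linarith+
  then show "b \<le> kemeny T" unfolding kemeny b_def by (rule diff_right_mono)
  have "kemeny T = b \<longleftrightarrow> real_of_int ?S / (n - 1) = real_of_int (min_dist_sum \<delta> r) / (n - 1)"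
    unfolding kemeny b_def by linarith
  also have "\<dots> \<longleftrightarrow> ?S = min_dist_sum \<delta> r"
    using n1 by (simp only: divide_cancel_right of_int_eq_iff less_irrefl) auto
  also have "\<dots> \<longleftrightarrow> (\<exists>c. tree_geodesic (pverts T) (neighbours T) (graph_dist T) c \<delta> \<and>
      pverts T - c ` {..\<delta>} \<subseteq> neighbours T (c (\<delta> div 2)))"
  proof
    assume "?S = min_dist_sum \<delta> r"
    then consider "G.off \<subseteq> neighbours T (c (\<delta> div 2))" | "G.off \<subseteq> neighbours T (c (\<delta> - \<delta> div 2))"
      using G.dist_sum_eq_imp_hub[OF pos] offr by auto
    then show "\<exists>c. tree_geodesic (pverts T) (neighbours T) (graph_dist T) c \<delta> \<and>
      pverts T - c ` {..\<delta>} \<subseteq> neighbours T (c (\<delta> div 2))"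
    proof cases
      case 1
      then show ?thesis using geo by (auto simp: G.off_def)
    next
      case 2
      have "(\<lambda>i. c (\<delta> - i)) ` {..\<delta>} = c ` {..\<delta>}"
      proof -
        have "(\<lambda>i. c (\<delta> - i)) ` {..\<delta>} = c ` ((\<lambda>i. \<delta> - i) ` {..\<delta>})" by (simp add: image_image)
        also have "(\<lambda>i. \<delta> - i) ` {..\<delta>} = {..\<delta>}"
        proof (intro set_eqI iffI)
          fix x assume "x \<in> {..\<delta>}"
          then show "x \<in> (\<lambda>i. \<delta> - i) ` {..\<delta>}" by (intro image_eqI[of _ _ "\<delta> - x"]) simp_all
        qed auto
        finally show ?thesis .
      qed
      then have "pverts T - (\<lambda>i. c (\<delta> - i)) ` {..\<delta>} \<subseteq> neighbours T ((\<lambda>i. c (\<delta> - i)) (\<delta> div 2))"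
        using 2 by (simp add: G.off_def)
      then show ?thesis using G.reverse_geodesic by blast
    qed
  next
    assume "\<exists>c. tree_geodesic (pverts T) (neighbours T) (graph_dist T) c \<delta> \<and>
      pverts T - c ` {..\<delta>} \<subseteq> neighbours T (c (\<delta> div 2))"
    then obtain c' where geo': "tree_geodesic (pverts T) (neighbours T) (graph_dist T) c' \<delta>"
      and hub: "pverts T - c' ` {..\<delta>} \<subseteq> neighbours T (c' (\<delta> div 2))" by blast
    interpret G': tree_geodesic "pverts T" "neighbours T" "graph_dist T" c' \<delta> by (rule geo')
    have "card G'.off = r" using G'.card_off card by simp
    then have "?S \<le> min_dist_sum \<delta> r" using G'.dist_sum_hub hub by (simp add: G'.off_def)
    then show "?S = min_dist_sum \<delta> r" using ge by simp
  qed
  also have "\<dots> \<longleftrightarrow> digraph_iso (with_proj T) (with_proj C)"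
    unfolding C_def by (rule iso_caterpillar_iff[OF card, symmetric])
  finally show "kemeny T = b \<longleftrightarrow> digraph_iso (with_proj T) (with_proj C)" .
qed

end

section \<open>The bound\<close>

theorem corollary4p4:
  fixes T :: "'a pair_pre_digraph" and n \<delta> :: nat
  assumes "undirected_tree T"
    and "n = card (pverts T)"
    and "n \<noteq> 1"
    and "\<delta> = graph_diameter T"
  shows "let N = real n; d = real \<delta>;
             t = nat \<lceil>(d + 1) / 2\<rceil>;
             C = caterpillar (\<delta> + 1) (\<lambda>i. (n - \<delta> - 1) * unit_vec t i);
             odd_bound = 1 / (N - 1) *
               (N * d ^ 2 / 2 - d ^ 3 / 6 + N ^ 2 - N * d - d ^ 2 / 2 - 2 * N + 7 / 6 * d + 1);
             even_bound = 1 / (N - 1) *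
               (N * d ^ 2 / 2 - d ^ 3 / 6 + N ^ 2 - N * d - d ^ 2 / 2 - 5 / 2 * N + 5 / 3 * d + 3 / 2)
         in (odd \<delta> \<longrightarrow>
               kemeny T \<ge> odd_bound \<and>
               (kemeny T = odd_bound \<longleftrightarrow> digraph_iso (with_proj T) (with_proj C))) \<and>
            (even \<delta> \<longrightarrow>
               kemeny T \<ge> even_bound \<and>
               (kemeny T = even_bound \<longleftrightarrow> digraph_iso (with_proj T) (with_proj C)))"
proof -
  interpret nontrivial_tree T
    using assms by unfold_locales auto
  have t: "nat \<lceil>(real \<delta> + 1) / 2\<rceil> = Suc (\<delta> div 2)"
  proof -
    have "\<lceil>(real \<delta> + 1) / 2\<rceil> = int (Suc (\<delta> div 2))"
    proof (rule ceiling_unique)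
      have "2 * (\<delta> div 2) \<le> \<delta>" "\<delta> \<le> 2 * (\<delta> div 2) + 1" by linarith+
      then have "2 * real (\<delta> div 2) \<le> real \<delta>" "real \<delta> \<le> 2 * real (\<delta> div 2) + 1"
        by linarith+
      then show "real_of_int (int (Suc (\<delta> div 2))) - 1 < (real \<delta> + 1) / 2"
        "(real \<delta> + 1) / 2 \<le> real_of_int (int (Suc (\<delta> div 2)))"
        by simp_all
    qed
    then show ?thesis by simp
  qed
  note main = kemeny_lower_bound[folded assms(2,4)]
  note closed = min_kemeny_closed_form[OF main(1,2)]
  show ?thesis
  proof (cases "even \<delta>")
    case True
    note bounds = main(3,4)[unfolded closed(2)[OF True]]
    show ?thesis
      unfolding Let_def t by (intro conjI impI; (rule bounds | erule notE, rule True))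
  next
    case False
    note bounds = main(3,4)[unfolded closed(1)[OF False]]
    show ?thesis
      unfolding Let_def t by (intro conjI impI; (rule bounds | rule notE[OF False], assumption))
  qed
qed

end
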